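(* Let $\mathbb{F}$ be a field, $K$ a filtered simplicial complex, $\mathcal{U}=\{U_i\}_{i}$ a finite cover of $K$ by filtered subcomplexes, and $n\ge 0$. Let $\mathbb{V}=\mathrm{H}_n(\mathcal{S}^{\mathrm{Tot}}_* )$ be the $n$-th homology persistence module of the total complex of the Mayer–Vietoris (Čech) double complex of $\mathcal{U}$, with its vertical filtration $0=F^{-1}\mathbb{V}\subseteq F^0\mathbb{V}\subseteq\dots\subseteq F^n\mathbb{V}=\mathbb{V}$. Let $\mathbb{G}=\bigoplus_{k=0}^n\mathbb{G}^k$ with $\mathbb{G}^k=F^k\mathbb{V}/F^{k-1}\mathbb{V}$, and let $\mathcal{G}=\{g_i\}_{1\le i\le G}$ be a finite barcode basis of $\mathbb{G}$, each $g_i$ lying in one of the summands $\mathbb{G}^k$. Let $\widetilde{\mathbb{G}}$ be the persistence module constructed from $\mathcal{G}$ and a choice of lifts $\mathcal{F}$ of its generators to $\mathbb{V}$, as defined in the context. Then there is an isomorphism of persistence modules $$\widetilde{\mathbb{G}}\cong\mathbb{V}.$$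
   Context: Persistence modules. A persistence module is a functor $\mathbb{V}$ from the poset $(\mathbb{R},\le)$ to $\mathbb{F}$-vector spaces, with structure maps $\mathbb{V}(r\le s):\mathbb{V}(r)\to\mathbb{V}(s)$; morphisms are natural transformations. For reals $a<b$, the interval module $\mathrm{I}(a,b)$ is $\mathbb{F}$ on $[a,b)$ and $0$ elsewhere, with identity structure maps inside $[a,b)$. A barcode basis of a persistence module $\mathbb{M}$ is a family of morphisms $g_i:\mathrm{I}(a_i,b_i)\to\mathbb{M}$ whose sum $\bigoplus_i\mathrm{I}(a_i,b_i)\to\mathbb{M}$ is an isomorphism; write $g_i\sim[a_i,b_i)$ and $g_i(r)\in\mathbb{M}(r)$ for the image of $1_{\mathbb{F}}$ at $r$ (zero if $r\notin[a_i,b_i)$). Double complex. A filtered simplicial complex is a functor $r\mapsto K_r$ from $(\mathbb{R},\le)$ to simplicial complexes with $K_r\subseteq K_s$ for $r\le s$. A cover by filtered subcomplexes $\mathcal{U}=\{U_i\}$ satisfies $K=\bigcup_i U_i$ (for each $r$). For a finite nonempty set $\sigma$ of indices put $U_\sigma=\bigcap_{i\in\sigma}U_i$. Let $S_q(-)$ denote simplicial $q$-chains with coefficients in $\mathbb{F}$ (a persistence module, taken pointwise in $r$) and $d$ the simplicial boundary. Set $\mathcal{S}_{p,q}=\bigoplus_{|\sigma|=p+1}S_q(U_\sigma)$ for $p,q\ge0$ and $0$ otherwise, with vertical differential $d$ and horizontal differential $\bar\delta=(-1)^q\delta$, where $\delta$ is the Čech differential (the alternating sum over faces of $\sigma$ of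 the inclusions $S_q(U_\sigma)\to S_q(U_\tau)$, $\tau\subset\sigma$, $|\tau|=|\sigma|-1$). The total complex is $\mathcal{S}^{\mathrm{Tot}}_n=\bigoplus_{p+q=n}\mathcal{S}_{p,q}$ with $d^{\mathrm{Tot}}=d+\bar\delta$. Its vertical filtration is $F^k\mathcal{S}^{\mathrm{Tot}}_n=\bigoplus_{p+q=n,\,p\le k}\mathcal{S}_{p,q}$, and $F^k\mathbb{V}=\operatorname{Im}\big(\mathrm{H}_n(F^k\mathcal{S}^{\mathrm{Tot}}_* )\to\mathrm{H}_n(\mathcal{S}^{\mathrm{Tot}}_* )\big)$. Let $p^k:F^k\mathbb{V}\to\mathbb{G}^k$ be the quotient morphism. It is assumed that the associated spectral sequence collapses after finitely many pages. The maps $\mathcal{F}(r)$. For each generator $g_i\sim[a_i,b_i)$ lying in $\mathbb{G}^k$, choose an element $\mathcal{F}(a_i)(g_i(a_i))\in F^k\mathbb{V}(a_i)$ with $p^k(a_i)\big(\mathcal{F}(a_i)(g_i(a_i))\big)=g_i(a_i)$, and for $a_i<r<b_i$ set $\mathcal{F}(r)(g_i(r))=\mathbb{V}(a_i\le r)\big(\mathcal{F}(a_i)(g_i(a_i))\big)$. Extending linearly for each $r$ over the basis $\{g_i(r): r\in[a_i,b_i)\}$ of $\mathbb{G}(r)$ gives linear maps $\mathcal{F}(r):\mathbb{G}(r)\to\mathbb{V}(r)$, which are isomorphisms of vector spaces (in general $\mathcal{F}$ is not a morphism of persistence modules $\mathbb{G}\to\mathbb{V}$). The module $\widetilde{\mathbb{G}}$.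 Put $\widetilde{\mathbb{G}}(s)=\mathbb{G}(s)$ for all $s\in\mathbb{R}$. For $1\le i\le G$ let $c_{i,j}\in\mathbb{F}$ be the coefficients determined by $$\sum_{j=1}^{G}c_{i,j}\,g_j(b_i)=\mathcal{F}(b_i)^{-1}\circ\mathbb{V}(a_i\le b_i)\circ\mathcal{F}(a_i)\,(g_i(a_i)),$$ with $c_{i,j}=0$ whenever $g_j(b_i)=0$. For $r\le s$ the linear map $\widetilde{\mathbb{G}}(r\le s)$ is defined on the basis elements $g_i(r)$ recursively by $$\widetilde{\mathbb{G}}(r\le s)(g_i(r))=\begin{cases}\sum_{j=1}^{G}c_{i,j}\,\widetilde{\mathbb{G}}(b_i\le s)(g_j(b_i)) & \text{if } r\in[a_i,b_i)\text{ and } b_i\le s,\\ g_i(s) & \text{if } r,s\in[a_i,b_i),\\ 0 & \text{otherwise.}\end{cases}$$ *)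

theory Defs
  imports
    "Jordan_Normal_Form.Missing_VectorSpace"
    "HOL-Algebra.Algebraic_Closure_Type"
    "HOL-Library.Poly_Mapping"
begin

(* Vector spaces are HOL-Algebra modules over a field, with linear maps module_hom.  The record fields
   monoid.mult and one of a module record (inherited from rings) play no role and are left undefined. *)

section \<open>Quotients and direct sums of vector spaces\<close>

definition quot_module :: "('f, 'a) module \<Rightarrow> 'a set \<Rightarrow> ('f, 'a set) module" where
  "quot_module M N =
     \<lparr>carrier = a_rcosets\<^bsub>M\<^esub> N, monoid.mult = undefined, one = undefined,
      zero = N, add = set_add M,
      module.smult = (\<lambda>c A. \<Union>x\<in>A. N +>\<^bsub>M\<^esub> (c \<odot>\<^bsub>M\<^esub> x))\<rparr>"

definition dsum_module :: "'j set \<Rightarrow> ('j \<Rightarrow> ('f, 'a) module) \<Rightarrow> ('f, 'j \<Rightarrow> 'a) module" where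
  "dsum_module J M =
     \<lparr>carrier = {x \<in> \<Pi>\<^sub>E j\<in>J. carrier (M j). finite {j \<in> J. x j \<noteq> \<zero>\<^bsub>M j\<^esub>}},
      monoid.mult = undefined, one = undefined,
      zero = (\<lambda>j\<in>J. \<zero>\<^bsub>M j\<^esub>), add = (\<lambda>x y. \<lambda>j\<in>J. x j \<oplus>\<^bsub>M j\<^esub> y j),
      module.smult = (\<lambda>c x. \<lambda>j\<in>J. c \<odot>\<^bsub>M j\<^esub> x j)\<rparr>"

section \<open>Persistence modules\<close>

record ('f, 'a) pmod =
  pspace :: "real \<Rightarrow> ('f, 'a) module"
  pmap :: "real \<Rightarrow> real \<Rightarrow> 'a \<Rightarrow> 'a"

locale persistence_module =
  fixes R :: "'f ring" and M :: "('f, 'a) pmod"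
  assumes vectorspace: "vectorspace R (pspace M r)"
    and map_hom: "r \<le> s \<Longrightarrow> pmap M r s \<in> LinearCombinations.module_hom R (pspace M r) (pspace M s)"
    and map_id: "x \<in> carrier (pspace M r) \<Longrightarrow> pmap M r r x = x"
    and map_comp: "r \<le> s \<Longrightarrow> s \<le> t \<Longrightarrow> x \<in> carrier (pspace M r) \<Longrightarrow>
      pmap M s t (pmap M r s x) = pmap M r t x"

definition pm_hom :: "'f ring \<Rightarrow> ('f, 'a) pmod \<Rightarrow> ('f, 'b) pmod \<Rightarrow> (real \<Rightarrow> 'a \<Rightarrow> 'b) set" where
  "pm_hom R M N = {\<phi>. (\<forall>r. \<phi> r \<in> LinearCombinations.module_hom R (pspace M r) (pspace N r)) \<and>
     (\<forall>r s. r \<le> s \<longrightarrow> (\<forall>x\<in>carrier (pspace M r). \<phi> s (pmap M r s x) = pmap N r s (\<phi> r x)))}"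

definition pm_iso :: "'f ring \<Rightarrow> ('f, 'a) pmod \<Rightarrow> ('f, 'b) pmod \<Rightarrow> (real \<Rightarrow> 'a \<Rightarrow> 'b) set" where
  "pm_iso R M N = {\<phi> \<in> pm_hom R M N.
     \<forall>r. bij_betw (\<phi> r) (carrier (pspace M r)) (carrier (pspace N r))}"

definition pm_isomorphic :: "'f ring \<Rightarrow> ('f, 'a) pmod \<Rightarrow> ('f, 'b) pmod \<Rightarrow> bool" where
  "pm_isomorphic R M N \<longleftrightarrow>
     persistence_module R M \<and> persistence_module R N \<and> pm_iso R M N \<noteq> {}"

definition pm_dsum :: "'j set \<Rightarrow> ('j \<Rightarrow> ('f, 'a) pmod) \<Rightarrow> ('f, 'j \<Rightarrow> 'a) pmod" where
  "pm_dsum J M =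
     \<lparr>pspace = (\<lambda>r. dsum_module J (\<lambda>j. pspace (M j) r)),
      pmap = (\<lambda>r s x. \<lambda>j\<in>J. pmap (M j) r s (x j))\<rparr>"

definition dsum_incl :: "'j set \<Rightarrow> ('j \<Rightarrow> ('f, 'a) pmod) \<Rightarrow> 'j \<Rightarrow> real \<Rightarrow> 'a \<Rightarrow> 'j \<Rightarrow> 'a" where
  "dsum_incl J M k r x = (\<lambda>j\<in>J. if j = k then x else \<zero>\<^bsub>pspace (M j) r\<^esub>)"

(* The sum of morphisms g j : M j -> N, as a map from the direct sum of the M j to N. *)
definition dsum_sum ::
    "'j set \<Rightarrow> ('j \<Rightarrow> ('f, 'a) pmod) \<Rightarrow> ('f, 'b) pmod \<Rightarrow> ('j \<Rightarrow> real \<Rightarrow> 'a \<Rightarrow> 'b) \<Rightarrow>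
     real \<Rightarrow> ('j \<Rightarrow> 'a) \<Rightarrow> 'b" where
  "dsum_sum J M N g r x =
     (\<Oplus>\<^bsub>pspace N r\<^esub>j\<in>{j \<in> J. x j \<noteq> \<zero>\<^bsub>pspace (M j) r\<^esub>}. g j r (x j))"

definition pm_image :: "(real \<Rightarrow> 'a \<Rightarrow> 'b) \<Rightarrow> ('f, 'a) pmod \<Rightarrow> ('f, 'b) pmod \<Rightarrow> ('f, 'b) pmod" where
  "pm_image \<phi> M N =
     \<lparr>pspace = (\<lambda>r. (pspace N r)\<lparr>carrier := \<phi> r ` carrier (pspace M r)\<rparr>), pmap = pmap N\<rparr>"

definition pm_proj :: "('f, 'a) pmod \<Rightarrow> ('f, 'a) pmod \<Rightarrow> real \<Rightarrow> 'a \<Rightarrow> 'a set" where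
  "pm_proj M N r x = carrier (pspace N r) +>\<^bsub>pspace M r\<^esub> x"

definition pm_quot :: "('f, 'a) pmod \<Rightarrow> ('f, 'a) pmod \<Rightarrow> ('f, 'a set) pmod" where
  "pm_quot M N =
     \<lparr>pspace = (\<lambda>r. quot_module (pspace M r) (carrier (pspace N r))),
      pmap = (\<lambda>r s A. \<Union>x\<in>A. pm_proj M N s (pmap M r s x))\<rparr>"

section \<open>Interval modules and barcode bases\<close>

definition interval_pm :: "'f ring \<Rightarrow> real \<Rightarrow> real \<Rightarrow> ('f, 'f) pmod" where
  "interval_pm R a b =
     \<lparr>pspace = (\<lambda>r. \<lparr>carrier = (if r \<in> {a..<b} then carrier R else {\<zero>\<^bsub>R\<^esub>}),
                    monoid.mult = undefined, one = undefined,
                    zero = \<zero>\<^bsub>R\<^esub>, add = (\<lambda>x y. x \<oplus>\<^bsub>R\<^esub> y), module.smult = (\<lambda>c x. c \<otimes>\<^bsub>R\<^esub> x)\<rparr>),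
      pmap = (\<lambda>r s x. if r \<in> {a..<b} \<and> s \<in> {a..<b} then x else \<zero>\<^bsub>R\<^esub>)\<rparr>"

definition barcode_basis ::
    "'f ring \<Rightarrow> ('f, 'a) pmod \<Rightarrow> 'j set \<Rightarrow> ('j \<Rightarrow> real) \<Rightarrow> ('j \<Rightarrow> real) \<Rightarrow>
     ('j \<Rightarrow> real \<Rightarrow> 'f \<Rightarrow> 'a) \<Rightarrow> bool" where
  "barcode_basis R M J a b g \<longleftrightarrow>
     (\<forall>j\<in>J. a j < b j \<and> g j \<in> pm_hom R (interval_pm R (a j) (b j)) M) \<and>
     dsum_sum J (\<lambda>j. interval_pm R (a j) (b j)) M g
       \<in> pm_iso R (pm_dsum J (\<lambda>j. interval_pm R (a j) (b j))) M"

definition barcode_gen ::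
    "'f ring \<Rightarrow> ('f, 'a) pmod \<Rightarrow> ('j \<Rightarrow> real) \<Rightarrow> ('j \<Rightarrow> real) \<Rightarrow>
     ('j \<Rightarrow> real \<Rightarrow> 'f \<Rightarrow> 'a) \<Rightarrow> 'j \<Rightarrow> real \<Rightarrow> 'a" where
  "barcode_gen R M a b g j r =
     (if r \<in> {a j..<b j} then g j r \<one>\<^bsub>R\<^esub> else \<zero>\<^bsub>pspace M r\<^esub>)"

section \<open>The module built from a barcode basis and lifts of its generators\<close>

(* The value of a sum depends only on the summands over the index set, also if these are not known
   to lie in the carrier.  The recursion below needs this to be recognised as terminating. *)
lemma finsum_fundef_cong [fundef_cong]:
  assumes "A = B" and eq: "\<And>i. i \<in> B \<Longrightarrow> f i = g i"
  shows "finsum M f A = finsum M g B"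
proof -
  have *: "(A, z) \<in> foldSetD D (h \<circ> f') e \<Longrightarrow> (\<And>i. i \<in> A \<Longrightarrow> f' i = g' i) \<Longrightarrow>
      (A, z) \<in> foldSetD D (h \<circ> g') e"
    for A :: "'a set" and z :: 'b and D e and h :: "'b \<Rightarrow> 'b \<Rightarrow> 'b" and f' g'
  proof (induction rule: foldSetD.induct)
    case (insertI x A y)
    have "(insert x A, (h \<circ> g') x y) \<in> foldSetD D (h \<circ> g') e"
      using insertI by (intro foldSetD.insertI) auto
    then show ?case using insertI.prems by (simp add: comp_def)
  qed (simp add: foldSetD.emptyI)
  have "(B, z) \<in> foldSetD D (h \<circ> f) e \<longleftrightarrow> (B, z) \<in> foldSetD D (h \<circ> g) e"
    for z D e and h :: "'b \<Rightarrow> 'b \<Rightarrow> 'b"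
    using *[of B z D h f e g] *[of B z D h g e f] eq by auto
  then show ?thesis
    by (simp add: \<open>A = B\<close> finsum_def finprod_def foldD_def)
qed

(* G has barcode basis g 1, ..., g m, and l i in V (a i) is a lift of g i (a i). *)
context
  fixes R :: "'f ring" and G :: "('f, 'g) pmod" and V :: "('f, 'v) pmod"
    and m :: nat and a b :: "nat \<Rightarrow> real" and g :: "nat \<Rightarrow> real \<Rightarrow> 'f \<Rightarrow> 'g" and l :: "nat \<Rightarrow> 'v"
begin

(* Coordinates of x in G r with respect to the basis of those g i r with r in [a i, b i);
   coordinate i is zero if r is not in [a i, b i). *)
definition barcode_coord :: "real \<Rightarrow> 'g \<Rightarrow> nat \<Rightarrow> 'f" where
  "barcode_coord r x =
     inv_into (carrier (pspace (pm_dsum {1..m} (\<lambda>i. interval_pm R (a i) (b i))) r))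
       (dsum_sum {1..m} (\<lambda>i. interval_pm R (a i) (b i)) G g r) x"

(* The linear map from G r to W that sends the basis element g i r to h i. *)
definition barcode_extend :: "real \<Rightarrow> ('f, 'w) module \<Rightarrow> (nat \<Rightarrow> 'w) \<Rightarrow> 'g \<Rightarrow> 'w" where
  "barcode_extend r W h x =
     (\<Oplus>\<^bsub>W\<^esub>i\<in>{i \<in> {1..m}. r \<in> {a i..<b i}}. barcode_coord r x i \<odot>\<^bsub>W\<^esub> h i)"

definition lift_map :: "real \<Rightarrow> 'g \<Rightarrow> 'v" where
  "lift_map r = barcode_extend r (pspace V r) (\<lambda>i. pmap V (a i) r (l i))"

definition tilde_coeff :: "nat \<Rightarrow> nat \<Rightarrow> 'f" where
  "tilde_coeff i =
     barcode_coord (b i) (inv_into (carrier (pspace G (b i))) (lift_map (b i))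
       (pmap V (a i) (b i) (lift_map (a i) (barcode_gen R G a b g i (a i)))))"

function tilde_gen :: "real \<Rightarrow> real \<Rightarrow> nat \<Rightarrow> 'g" where
  "tilde_gen r s i =
     (if r \<in> {a i..<b i} \<and> b i \<le> s
      then \<Oplus>\<^bsub>pspace G s\<^esub>j\<in>{1..m}. tilde_coeff i j \<odot>\<^bsub>pspace G s\<^esub> tilde_gen (b i) s j
      else if r \<in> {a i..<b i} \<and> s \<in> {a i..<b i} then barcode_gen R G a b g i s
      else \<zero>\<^bsub>pspace G s\<^esub>)"
  by auto
(* At a recursive call r increases to b i, past the right end of the bar i. *)
termination
proof (relation "Wellfounded.measure (\<lambda>(r, s, i). card {j \<in> insert i {1..m}. r < b j})", goal_cases)
  case 1
  show ?case by simp
next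
  case (2 r s i j)
  then have "{k \<in> insert j {1..m}. b i < b k} \<subset> {k \<in> insert i {1..m}. r < b k}"
    by (auto simp: insert_absorb)
  then show ?case
    by (auto intro!: psubset_card_mono)
qed

definition tilde_pm :: "('f, 'g) pmod" where
  "tilde_pm =
     \<lparr>pspace = pspace G, pmap = (\<lambda>r s. barcode_extend r (pspace G s) (tilde_gen r s))\<rparr>"

end

declare tilde_gen.simps [simp del]

section \<open>Homology of complexes of persistence modules\<close>

(* A complex consists of persistence modules C n for n :: nat and differentials
   D n r : C n r -> C (n - 1) r, where D 0 r is the zero map. *)

definition pm_cycles :: "(nat \<Rightarrow> ('f, 'a) pmod) \<Rightarrow> (nat \<Rightarrow> real \<Rightarrow> 'a \<Rightarrow> 'a) \<Rightarrow> nat \<Rightarrow> real \<Rightarrow> 'a set" where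
  "pm_cycles C D n r = {x \<in> carrier (pspace (C n) r). D n r x = \<zero>\<^bsub>pspace (C (n - 1)) r\<^esub>}"

definition pm_boundaries :: "(nat \<Rightarrow> ('f, 'a) pmod) \<Rightarrow> (nat \<Rightarrow> real \<Rightarrow> 'a \<Rightarrow> 'a) \<Rightarrow> nat \<Rightarrow> real \<Rightarrow> 'a set" where
  "pm_boundaries C D n r = D (Suc n) r ` carrier (pspace (C (Suc n)) r)"

definition pm_homology :: "(nat \<Rightarrow> ('f, 'a) pmod) \<Rightarrow> (nat \<Rightarrow> real \<Rightarrow> 'a \<Rightarrow> 'a) \<Rightarrow> nat \<Rightarrow> ('f, 'a set) pmod" where
  "pm_homology C D n =
     \<lparr>pspace = (\<lambda>r. quot_module ((pspace (C n) r)\<lparr>carrier := pm_cycles C D n r\<rparr>)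
                                (pm_boundaries C D n r)),
      pmap = (\<lambda>r s A. \<Union>x\<in>A. pm_boundaries C D n s +>\<^bsub>pspace (C n) s\<^esub> pmap (C n) r s x)\<rparr>"

(* The map into the homology of (C, D) induced by the inclusion of a subcomplex. *)
definition pm_homology_incl ::
    "(nat \<Rightarrow> ('f, 'a) pmod) \<Rightarrow> (nat \<Rightarrow> real \<Rightarrow> 'a \<Rightarrow> 'a) \<Rightarrow> nat \<Rightarrow> real \<Rightarrow> 'a set \<Rightarrow> 'a set" where
  "pm_homology_incl C D n r A = (\<Union>x\<in>A. pm_boundaries C D n r +>\<^bsub>pspace (C n) r\<^esub> x)"

section \<open>Filtered simplicial complexes and simplicial chains\<close>

definition simplicial_complex :: "'v set set \<Rightarrow> bool" where
  "simplicial_complex L \<longleftrightarrow>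
     (\<forall>\<tau>\<in>L. finite \<tau> \<and> \<tau> \<noteq> {}) \<and> (\<forall>\<tau>\<in>L. \<forall>\<rho>. \<rho> \<subseteq> \<tau> \<and> \<rho> \<noteq> {} \<longrightarrow> \<rho> \<in> L)"

definition filtered_complex :: "(real \<Rightarrow> 'v set set) \<Rightarrow> bool" where
  "filtered_complex L \<longleftrightarrow> (\<forall>r. simplicial_complex (L r)) \<and> (\<forall>r s. r \<le> s \<longrightarrow> L r \<subseteq> L s)"

(* A simplex stands for its increasing ordering, so that deleting its k-th vertex (counting from 0)
   gives the sign (-1)^k. *)
definition face_sign :: "'a::linorder set \<Rightarrow> 'a \<Rightarrow> 'f::field" where
  "face_sign \<tau> v = (-1) ^ card {w \<in> \<tau>. w < v}"

definition chain_module :: "nat \<Rightarrow> 'v set set \<Rightarrow> ('f::field, 'v set \<Rightarrow>\<^sub>0 'f) module" where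
  "chain_module q L =
     \<lparr>carrier = {c. Poly_Mapping.keys c \<subseteq> {\<tau> \<in> L. card \<tau> = Suc q}}, monoid.mult = undefined, one = undefined,
      zero = 0, add = (+), module.smult = (\<lambda>t. Poly_Mapping.map ((*) t))\<rparr>"

definition chain_pm :: "nat \<Rightarrow> (real \<Rightarrow> 'v set set) \<Rightarrow> ('f::field, 'v set \<Rightarrow>\<^sub>0 'f) pmod" where
  "chain_pm q L = \<lparr>pspace = (\<lambda>r. chain_module q (L r)), pmap = (\<lambda>r s c. c)\<rparr>"

definition simplicial_boundary :: "nat \<Rightarrow> ('v::linorder set \<Rightarrow>\<^sub>0 'f::field) \<Rightarrow> ('v set \<Rightarrow>\<^sub>0 'f)" where
  "simplicial_boundary q c =
     (if q = 0 then 0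
      else \<Sum>\<tau>\<in>Poly_Mapping.keys c. \<Sum>v\<in>\<tau>. Poly_Mapping.single (\<tau> - {v}) (face_sign \<tau> v * Poly_Mapping.lookup c \<tau>))"

section \<open>The Mayer--Vietoris double complex\<close>

type_synonym ('i, 'v, 'f) dchain = "'i set \<Rightarrow> ('v set \<Rightarrow>\<^sub>0 'f)"
type_synonym ('i, 'v, 'f) tchain = "nat \<Rightarrow> ('i, 'v, 'f) dchain"

definition index_simplices :: "'i set \<Rightarrow> nat \<Rightarrow> 'i set set" where
  "index_simplices I p = {\<sigma>. \<sigma> \<subseteq> I \<and> card \<sigma> = Suc p}"

definition dcomplex ::
    "'i set \<Rightarrow> ('i \<Rightarrow> real \<Rightarrow> 'v set set) \<Rightarrow> nat \<Rightarrow> nat \<Rightarrow> ('f::field, ('i, 'v, 'f) dchain) pmod" where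
  "dcomplex I U p q = pm_dsum (index_simplices I p) (\<lambda>\<sigma>. chain_pm q (\<lambda>r. \<Inter>i\<in>\<sigma>. U i r))"

(* From bidegree (p, q) to (p, q - 1). *)
definition vdiff ::
    "'i set \<Rightarrow> nat \<Rightarrow> nat \<Rightarrow> ('i, 'v::linorder, 'f::field) dchain \<Rightarrow> ('i, 'v, 'f) dchain" where
  "vdiff I p q x = (\<lambda>\<sigma>\<in>index_simplices I p. simplicial_boundary q (x \<sigma>))"

(* From bidegree (p + 1, q) to (p, q): the component at \<tau> collects the contributions of all \<sigma>
   that have \<tau> as the face opposite to the index i. *)
definition cech_diff ::
    "'i::linorder set \<Rightarrow> nat \<Rightarrow> ('i, 'v, 'f::field) dchain \<Rightarrow> ('i, 'v, 'f) dchain" where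
  "cech_diff I p x =
     (\<lambda>\<tau>\<in>index_simplices I p.
        \<Sum>i\<in>I - \<tau>. Poly_Mapping.map ((*) (face_sign (insert i \<tau>) i)) (x (insert i \<tau>)))"

definition hdiff ::
    "'i::linorder set \<Rightarrow> nat \<Rightarrow> nat \<Rightarrow> ('i, 'v, 'f::field) dchain \<Rightarrow> ('i, 'v, 'f) dchain" where
  "hdiff I p q x =
     (\<lambda>\<tau>\<in>index_simplices I p. Poly_Mapping.map ((*) ((-1) ^ q)) (cech_diff I p x \<tau>))"

definition tot_complex ::
    "'i set \<Rightarrow> ('i \<Rightarrow> real \<Rightarrow> 'v set set) \<Rightarrow> nat \<Rightarrow> ('f::field, ('i, 'v, 'f) tchain) pmod" where
  "tot_complex I U n = pm_dsum {..n} (\<lambda>p. dcomplex I U p (n - p))"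

(* The component in bidegree (p, n - 1 - p) receives the vertical differential of the component in
   bidegree (p, n - p) and the horizontal one of the component in bidegree (p + 1, n - 1 - p). *)
definition tot_diff ::
    "'i::linorder set \<Rightarrow> nat \<Rightarrow> real \<Rightarrow> ('i, 'v::linorder, 'f::field) tchain \<Rightarrow> ('i, 'v, 'f) tchain" where
  "tot_diff I n r x =
     (\<lambda>p\<in>{..n - 1}. \<lambda>\<sigma>\<in>index_simplices I p.
        if n = 0 then 0
        else vdiff I p (n - p) (x p) \<sigma> + hdiff I p (n - 1 - p) (x (Suc p)) \<sigma>)"

(* Filtration degrees are integers, so that degree -1 gives the zero complex. *)
definition tot_filt ::
    "'i set \<Rightarrow> ('i \<Rightarrow> real \<Rightarrow> 'v set set) \<Rightarrow> int \<Rightarrow> nat \<Rightarrow> ('f::field, ('i, 'v, 'f) tchain) pmod" where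
  "tot_filt I U k n =
     \<lparr>pspace = (\<lambda>r. (pspace (tot_complex I U n) r)\<lparr>carrier :=
        {x \<in> carrier (pspace (tot_complex I U n) r).
           \<forall>p\<le>n. k < int p \<longrightarrow> x p = \<zero>\<^bsub>pspace (dcomplex I U p (n - p)) r\<^esub>}\<rparr>),
      pmap = pmap (tot_complex I U n)\<rparr>"

definition mv_homology ::
    "'i::linorder set \<Rightarrow> ('i \<Rightarrow> real \<Rightarrow> 'v::linorder set set) \<Rightarrow> nat \<Rightarrow>
     ('f::field, ('i, 'v, 'f) tchain set) pmod" where
  "mv_homology I U n = pm_homology (tot_complex I U) (tot_diff I) n"

definition mv_filt ::
    "'i::linorder set \<Rightarrow> ('i \<Rightarrow> real \<Rightarrow> 'v::linorder set set) \<Rightarrow> nat \<Rightarrow> int \<Rightarrow>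
     ('f::field, ('i, 'v, 'f) tchain set) pmod" where
  "mv_filt I U n k =
     pm_image (pm_homology_incl (tot_complex I U :: nat \<Rightarrow> ('f, ('i, 'v, 'f) tchain) pmod) (tot_diff I) n)
       (pm_homology (tot_filt I U k) (tot_diff I) n) (mv_homology I U n)"

definition mv_graded_part ::
    "'i::linorder set \<Rightarrow> ('i \<Rightarrow> real \<Rightarrow> 'v::linorder set set) \<Rightarrow> nat \<Rightarrow> int \<Rightarrow>
     ('f::field, ('i, 'v, 'f) tchain set set) pmod" where
  "mv_graded_part I U n k = pm_quot (mv_filt I U n k) (mv_filt I U n (k - 1))"

definition mv_graded ::
    "'i::linorder set \<Rightarrow> ('i \<Rightarrow> real \<Rightarrow> 'v::linorder set set) \<Rightarrow> nat \<Rightarrow>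
     ('f::field, int \<Rightarrow> ('i, 'v, 'f) tchain set set) pmod" where
  "mv_graded I U n = pm_dsum {0..int n} (mv_graded_part I U n)"

end

(* The lifts define isomorphisms F(r) from G(r) to V(r) for every r: the associated graded of a
   finite filtration has the g_i(r) with r in [a_i, b_i) as a basis, and lifting a basis of the
   associated graded gives a basis of the filtered space (induction on the filtration degree).
   These isomorphisms commute with the structure maps of the new module and of V, by induction along
   the recursion over the right ends b_i: at b_i the coefficients c_ij are chosen precisely
   so that F(b_i) maps sum_j c_ij g_j(b_i) to the transported lift of g_i.  The functoriality of the
   new module is then transported from V. *)
theory Submission
  imports Defs
begin

text \<open>The obstacle is that F does not commute with the structure maps of G. At b_i the
  generator g_i dies in its summand G^k, while its lift, transported to V(b_i), has merely dropped
  into F^(k-1) and may be nonzero. Passing to the graded module forgets this extension; the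
  coefficients c_ij record it. A generator alive at b_i can itself end before s, so a single
  expansion does not suffice, which explains the recursion. A lift is chosen at the left end a_i
  only, yet a basis is needed at every r. Structure maps respect the filtration, so they carry
  classes modulo F^(k-1) to such classes; together with the naturality of g_i this shows that g_i(r)
  is the class of the transported lift throughout the bar. What remains is linear algebra in one
  filtered vector space at a time. The double complex enters through the shape of its filtration: in
  total degree n the first degree p runs from 0 to n, so the filtration on homology climbs from zero
  at -1 to everything at n.\<close>

section \<open>Vector spaces\<close>

lemma vectorspace_surj_image:
  assumes M: "vectorspace R M" and surj: "f ` carrier M = carrier N"
    and add: "\<And>x y. x \<in> carrier M \<Longrightarrow> y \<in> carrier M \<Longrightarrow> f (x \<oplus>\<^bsub>M\<^esub> y) = f x \<oplus>\<^bsub>N\<^esub> f y"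
    and smult: "\<And>c x. c \<in> carrier R \<Longrightarrow> x \<in> carrier M \<Longrightarrow> f (c \<odot>\<^bsub>M\<^esub> x) = c \<odot>\<^bsub>N\<^esub> f x"
    and zero: "f \<zero>\<^bsub>M\<^esub> = \<zero>\<^bsub>N\<^esub>"
  shows "vectorspace R N"
proof -
  interpret M: vectorspace R M by (rule M)
  \<comment> \<open>Additive inverses are the axiom that needs a witness: the opposite of
    \<open>f x\<close> is \<open>f\<close> of the opposite of x. The other axioms are equations and
    closure conditions carried along f.\<close>
  have neg: "\<exists>y\<in>carrier M. f (x \<oplus>\<^bsub>M\<^esub> y) = f \<zero>\<^bsub>M\<^esub>" if "x \<in> carrier M" for x
    using that by (intro bexI[of _ "\<ominus>\<^bsub>M\<^esub> x"]) (auto simp: M.M.r_neg)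
  show ?thesis
    by (rule vs_criteria)
      (auto simp flip: surj add smult zero simp: M.field_axioms M.M.a_ac neg M.smult_l_distr
        M.smult_r_distr M.smult_assoc1)
qed

lemma vectorspace_submodule:
  assumes "vectorspace R M" "submodule R N M"
  shows "vectorspace R (M\<lparr>carrier := N\<rparr>)"
  using assms vectorspace.subspace_is_vs subspace.intro by blast

text \<open>Closure and linearity of \<open>f\<close> are required on Z alone. This suits the class
  map of homology, whose values are known to be homology classes for cycles.\<close>

lemma submodule_hom_image:
  assumes M: "submodule R Z M" and N: "Module.module R N"
    and cl: "\<And>x. x \<in> Z \<Longrightarrow> f x \<in> carrier N"
    and add: "\<And>x y. x \<in> Z \<Longrightarrow> y \<in> Z \<Longrightarrow> f (x \<oplus>\<^bsub>M\<^esub> y) = f x \<oplus>\<^bsub>N\<^esub> f y"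
    and smult: "\<And>c x. c \<in> carrier R \<Longrightarrow> x \<in> Z \<Longrightarrow> f (c \<odot>\<^bsub>M\<^esub> x) = c \<odot>\<^bsub>N\<^esub> f x"
  shows "submodule R (f ` Z) N"
proof -
  interpret M: submodule R Z M by (rule M)
  interpret MM: Module.module R M by (rule M.module)
  interpret N: Module.module R N by (rule N)
  have "f \<zero>\<^bsub>M\<^esub> = \<zero>\<^bsub>N\<^esub>"
    using smult[of "\<zero>\<^bsub>R\<^esub>" "\<zero>\<^bsub>M\<^esub>"] cl by simp
  then have "\<zero>\<^bsub>N\<^esub> \<in> f ` Z"
    by (metis M.zero_closed image_eqI)
  then show ?thesis
    by unfold_locales (auto simp: cl simp flip: add smult)
qed

lemma (in mod_hom) hom_finsum:
  assumes "finite A" "h \<in> A \<rightarrow> carrier M"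
  shows "f (\<Oplus>\<^bsub>M\<^esub>i\<in>A. h i) = (\<Oplus>\<^bsub>N\<^esub>i\<in>A. f (h i))"
  using assms by (induction A) (auto simp: Pi_iff)

lemma (in Module.module) finsum_smult_Kronecker:
  assumes "finite A" "i \<in> A" "v \<in> A \<rightarrow> carrier M"
  shows "(\<Oplus>\<^bsub>M\<^esub>j\<in>A. (if j = i then \<one>\<^bsub>R\<^esub> else \<zero>\<^bsub>R\<^esub>) \<odot>\<^bsub>M\<^esub> v j) = v i"
proof -
  have "(\<Oplus>\<^bsub>M\<^esub>j\<in>A. (if j = i then \<one>\<^bsub>R\<^esub> else \<zero>\<^bsub>R\<^esub>) \<odot>\<^bsub>M\<^esub> v j)
      = (\<Oplus>\<^bsub>M\<^esub>j\<in>A. if j = i then v j else \<zero>\<^bsub>M\<^esub>)"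
    using assms by (intro M.finsum_cong') (auto simp: Pi_iff)
  then show ?thesis
    using M.add.finprod_singleton_swap[of i A v] assms by simp
qed

lemma module_hom_comp:
  assumes "f \<in> LinearCombinations.module_hom R M N" "h \<in> LinearCombinations.module_hom R N P"
  shows "(\<lambda>x. h (f x)) \<in> LinearCombinations.module_hom R M P"
  using assms by (auto simp: LinearCombinations.module_hom_def Pi_iff)

subsection \<open>Cosets\<close>

text \<open>Cosets and their sums involve the addition of M but not its carrier, so cosets formed
  inside a subspace are the same sets as in the ambient space. Quotients of subspaces can thus be
  computed in the ambient space.\<close>

lemma coset_carrier_update [simp]:
  "a_r_coset (M\<lparr>carrier := Z\<rparr>) = a_r_coset M" "set_add (M\<lparr>carrier := Z\<rparr>) = set_add M"
  by (simp_all add: a_r_coset_def r_coset_def set_add_def set_mult_def fun_eq_iff)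

lemma quot_module_carrier: "carrier (quot_module M N) = (\<lambda>x. N +>\<^bsub>M\<^esub> x) ` carrier M"
  by (auto simp: quot_module_def A_RCOSETS_def RCOSETS_def a_r_coset_def r_coset_def)

context submodule
begin

text \<open>Closure under negation comes from multiplying by -1. This gives access to the coset
  theory of abelian groups.\<close>

lemma is_abelian_subgroup: "abelian_subgroup N M"
proof -
  interpret Module.module R M by (rule module)
  have "\<ominus>\<^bsub>M\<^esub> x \<in> N" if "x \<in> N" for x
  proof -
    have "\<ominus>\<^bsub>M\<^esub> x = (\<ominus>\<^bsub>R\<^esub> \<one>\<^bsub>R\<^esub>) \<odot>\<^bsub>M\<^esub> x"
      using that subset by (subst smult_l_minus) auto
    also have "\<dots> \<in> N"
      using that by (intro submodule.smult_closed[OF submodule_axioms]) auto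
    finally show ?thesis .
  qed
  moreover have ne: "N \<noteq> {}"
    using submodule.zero_closed[OF submodule_axioms] by blast
  ultimately show ?thesis
    using subset by (intro abelian_subgroupI3 additive_subgroup.intro add.subgroupI)
      (auto simp: M.abelian_group_axioms simp flip: a_inv_def)
qed

lemma coset_self: "x \<in> carrier M \<Longrightarrow> x \<in> N +>\<^bsub>M\<^esub> x"
  using abelian_subgroup.a_rcos_self[OF is_abelian_subgroup] .

lemma coset_cong:
  assumes "y \<in> N +>\<^bsub>M\<^esub> x" "x \<in> carrier M"
  shows "N +>\<^bsub>M\<^esub> y = N +>\<^bsub>M\<^esub> x" "y \<in> carrier M"
  using abelian_subgroup.a_repr_independence'[OF is_abelian_subgroup] assms apply simp
  by (meson abelian_subgroup.a_elemrcos_carrier assms is_abelian_subgroup)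

text \<open>Scalar multiples and structure maps on quotients are defined as unions over all
  representatives. Such a union collapses to its value at one representative once h is constant on
  the coset.\<close>

lemma coset_UN:
  assumes "x \<in> carrier M" "\<And>y. y \<in> N +>\<^bsub>M\<^esub> x \<Longrightarrow> h y = h x"
  shows "(\<Union>y\<in>N +>\<^bsub>M\<^esub> x. h y) = h x"
  using assms coset_self by blast

lemma coset_eq_iff:
  assumes "x \<in> carrier M" "y \<in> carrier M"
  shows "N +>\<^bsub>M\<^esub> x = N +>\<^bsub>M\<^esub> y \<longleftrightarrow> x \<ominus>\<^bsub>M\<^esub> y \<in> N"
proof -
  interpret abelian_subgroup N M by (rule is_abelian_subgroup)
  have "N +>\<^bsub>M\<^esub> x = N +>\<^bsub>M\<^esub> y \<longleftrightarrow> x \<in> N +>\<^bsub>M\<^esub> y"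
    using a_repr_independence'[of x y] a_rcos_self[of x] assms by auto
  then show ?thesis
    using a_rcos_module[of y x] assms by (simp add: a_minus_def)
qed

lemma coset_zero_iff:
  assumes "x \<in> carrier M"
  shows "N +>\<^bsub>M\<^esub> x = N \<longleftrightarrow> x \<in> N"
  using abelian_subgroup.a_rcos_const[OF is_abelian_subgroup, of x] coset_self[OF assms] by auto

lemma coset_add:
  "x \<in> carrier M \<Longrightarrow> y \<in> carrier M \<Longrightarrow> set_add M (N +>\<^bsub>M\<^esub> x) (N +>\<^bsub>M\<^esub> y) = N +>\<^bsub>M\<^esub> (x \<oplus>\<^bsub>M\<^esub> y)"
  using abelian_subgroup.a_rcos_sum[OF is_abelian_subgroup] .

lemma coset_smult_cong:
  assumes "y \<in> N +>\<^bsub>M\<^esub> x" "x \<in> carrier M" "c \<in> carrier R"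
  shows "N +>\<^bsub>M\<^esub> (c \<odot>\<^bsub>M\<^esub> y) = N +>\<^bsub>M\<^esub> (c \<odot>\<^bsub>M\<^esub> x)"
proof -
  interpret Module.module R M by (rule module)
  have y: "y \<in> carrier M" "y \<ominus>\<^bsub>M\<^esub> x \<in> N"
    using coset_cong[OF assms(1,2)] coset_eq_iff[of y x] assms by auto
  have "c \<odot>\<^bsub>M\<^esub> y \<ominus>\<^bsub>M\<^esub> c \<odot>\<^bsub>M\<^esub> x = c \<odot>\<^bsub>M\<^esub> (y \<ominus>\<^bsub>M\<^esub> x)"
    using y assms by (simp add: a_minus_def smult_r_distr smult_r_minus)
  then show ?thesis
    using y assms by (subst coset_eq_iff) auto
qed

end

text \<open>The operations on cosets are computed in the ambient M; the restricted carrier Z only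
  decides which cosets belong to the quotient.\<close>

lemma quot_module_coset:
  fixes M :: "('f, 'a) module"
  assumes N: "LinearCombinations.submodule R N M"
    and "x \<in> carrier M" "y \<in> carrier M" "c \<in> carrier R"
  shows "(N +>\<^bsub>M\<^esub> x) \<oplus>\<^bsub>quot_module (M\<lparr>carrier := Z\<rparr>) N\<^esub> (N +>\<^bsub>M\<^esub> y) = N +>\<^bsub>M\<^esub> (x \<oplus>\<^bsub>M\<^esub> y)"
    and "c \<odot>\<^bsub>quot_module (M\<lparr>carrier := Z\<rparr>) N\<^esub> (N +>\<^bsub>M\<^esub> x) = N +>\<^bsub>M\<^esub> (c \<odot>\<^bsub>M\<^esub> x)"
proof -
  interpret submodule R N M by (rule N)
  show "(N +>\<^bsub>M\<^esub> x) \<oplus>\<^bsub>quot_module (M\<lparr>carrier := Z\<rparr>) N\<^esub> (N +>\<^bsub>M\<^esub> y) = N +>\<^bsub>M\<^esub> (x \<oplus>\<^bsub>M\<^esub> y)"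
    using assms by (simp add: quot_module_def coset_add)
  show "c \<odot>\<^bsub>quot_module (M\<lparr>carrier := Z\<rparr>) N\<^esub> (N +>\<^bsub>M\<^esub> x) = N +>\<^bsub>M\<^esub> (c \<odot>\<^bsub>M\<^esub> x)"
    using assms coset_UN[of x "\<lambda>x. N +>\<^bsub>M\<^esub> (c \<odot>\<^bsub>M\<^esub> x)"]
    by (simp add: quot_module_def coset_smult_cong)
qed

lemma quot_module_zero:
  fixes M :: "('f, 'a) module"
  assumes N: "LinearCombinations.submodule R N M"
  shows "\<zero>\<^bsub>quot_module (M\<lparr>carrier := Z\<rparr>) N\<^esub> = N +>\<^bsub>M\<^esub> \<zero>\<^bsub>M\<^esub>"
proof -
  interpret submodule R N M by (rule N)
  show ?thesis
    using coset_zero_iff[of "\<zero>\<^bsub>M\<^esub>"] zero_closed subset by (simp add: quot_module_def subset_iff)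
qed

lemma quot_module_vectorspace:
  fixes M :: "('f, 'a) module"
  assumes N: "LinearCombinations.submodule R N M"
    and Z: "vectorspace R (M\<lparr>carrier := Z\<rparr>)" "Z \<subseteq> carrier M"
  shows "vectorspace R (quot_module (M\<lparr>carrier := Z\<rparr>) N)"
proof -
  interpret R: vectorspace R "M\<lparr>carrier := Z\<rparr>" by (rule Z)
  show ?thesis
    by (rule vectorspace_surj_image[OF Z(1), where f = "\<lambda>x. N +>\<^bsub>M\<^esub> x"])
      (use Z(2) quot_module_coset[OF N, of _ _ "\<one>\<^bsub>R\<^esub>" Z] quot_module_coset(2)[OF N, of _ _ _ Z]
        quot_module_carrier[of "M\<lparr>carrier := Z\<rparr>" N] quot_module_zero[OF N, of Z] in \<open>auto simp: subset_iff\<close>)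
qed

section \<open>Direct sums of vector spaces and of persistence modules\<close>

lemma dsum_module_vectorspace:
  assumes R: "field R" and M: "\<And>j. j \<in> J \<Longrightarrow> vectorspace R (M j)"
  shows "vectorspace R (dsum_module J M)"
proof -
  have mod: "Module.module R (M j)" and ab: "abelian_group (M j)" "abelian_monoid (M j)" if "j \<in> J" for j
    using M[OF that] by (auto simp: vectorspace_def Module.module_def abelian_group_def)
  have minus_zero: "\<ominus>\<^bsub>M j\<^esub> \<zero>\<^bsub>M j\<^esub> = \<zero>\<^bsub>M j\<^esub>" if "j \<in> J" for j
  proof -
    interpret abelian_group "M j" using that by (rule ab)
    show ?thesis using r_neg[of "\<zero>\<^bsub>M j\<^esub>"] by simp
  qed
  note am = abelian_monoid.a_closed[OF ab(2)] abelian_monoid.zero_closed[OF ab(2)] abelian_monoid.r_zero[OF ab(2)]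
    abelian_monoid.a_assoc[OF ab(2)] module.smult_closed[OF mod] module.smult_assoc1[OF mod]
    module.smult_one[OF mod] module.smult_l_distr[OF mod] module.smult_r_distr[OF mod]
    module.smult_r_null[OF mod] abelian_group.r_neg[OF ab(1)] abelian_group.a_inv_closed[OF ab(1)]
    minus_zero
  \<comment> \<open>The support of a coordinatewise operation that sends zeros to zero lies in the
    union of the supports. Unary operations are the case y = x.\<close>
  have fin: "finite {j \<in> J. h j \<noteq> \<zero>\<^bsub>M j\<^esub>}"
    if "finite {j \<in> J. x j \<noteq> \<zero>\<^bsub>M j\<^esub>}" "finite {j \<in> J. y j \<noteq> \<zero>\<^bsub>M j\<^esub>}"
      "\<And>j. j \<in> J \<Longrightarrow> x j = \<zero>\<^bsub>M j\<^esub> \<Longrightarrow> y j = \<zero>\<^bsub>M j\<^esub> \<Longrightarrow> h j = \<zero>\<^bsub>M j\<^esub>" for h x y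
    by (rule finite_subset[OF _ finite_UnI[OF that(1,2)]]) (use that(3) in auto)
  have neg: "(\<lambda>j\<in>J. \<ominus>\<^bsub>M j\<^esub> x j) \<in> carrier (dsum_module J M)"
      "x \<oplus>\<^bsub>dsum_module J M\<^esub> (\<lambda>j\<in>J. \<ominus>\<^bsub>M j\<^esub> x j) = \<zero>\<^bsub>dsum_module J M\<^esub>"
    if "x \<in> carrier (dsum_module J M)" for x
    using that fin[of x x "\<lambda>j\<in>J. \<ominus>\<^bsub>M j\<^esub> x j"]
    by (auto simp: dsum_module_def PiE_iff am fun_eq_iff)
  have add_cl: "x \<oplus>\<^bsub>dsum_module J M\<^esub> y \<in> carrier (dsum_module J M)"
    if "x \<in> carrier (dsum_module J M)" "y \<in> carrier (dsum_module J M)" for x y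
    using that fin[of x y "\<lambda>j\<in>J. x j \<oplus>\<^bsub>M j\<^esub> y j"]
    by (auto simp: dsum_module_def PiE_iff am)
  have smult_cl: "c \<odot>\<^bsub>dsum_module J M\<^esub> x \<in> carrier (dsum_module J M)"
    if "x \<in> carrier (dsum_module J M)" "c \<in> carrier R" for x c
    using that fin[of x x "\<lambda>j\<in>J. c \<odot>\<^bsub>M j\<^esub> x j"]
    by (auto simp: dsum_module_def PiE_iff am)
  show ?thesis
  proof (rule vs_criteria[OF R])
    show "\<forall>v w. v \<in> carrier (dsum_module J M) \<and> w \<in> carrier (dsum_module J M) \<longrightarrow>
      v \<oplus>\<^bsub>dsum_module J M\<^esub> w = w \<oplus>\<^bsub>dsum_module J M\<^esub> v"
      by (auto simp: dsum_module_def PiE_iff fun_eq_iff abelian_monoid.a_comm[OF ab(2)])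
    show "\<forall>v\<in>carrier (dsum_module J M). \<exists>w\<in>carrier (dsum_module J M).
        v \<oplus>\<^bsub>dsum_module J M\<^esub> w = \<zero>\<^bsub>dsum_module J M\<^esub>"
      using neg by blast
    show "\<forall>v w. v \<in> carrier (dsum_module J M) \<and> w \<in> carrier (dsum_module J M) \<longrightarrow>
        v \<oplus>\<^bsub>dsum_module J M\<^esub> w \<in> carrier (dsum_module J M)"
      using add_cl by blast
    show "\<forall>c v. c \<in> carrier R \<and> v \<in> carrier (dsum_module J M) \<longrightarrow>
        c \<odot>\<^bsub>dsum_module J M\<^esub> v \<in> carrier (dsum_module J M)"
      using smult_cl by blast
  qed (auto simp: dsum_module_def PiE_iff am fun_eq_iff extensional_def)
qed

lemma persistence_module_dsum:
  assumes R: "field R" and M: "\<And>j. j \<in> J \<Longrightarrow> persistence_module R (M j)"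
  shows "persistence_module R (pm_dsum J M)"
proof (rule persistence_module.intro)
  have vs: "vectorspace R (pspace (M j) r)" if "j \<in> J" for j r
    by (rule persistence_module.vectorspace[OF M[OF that]])
  show "vectorspace R (pspace (pm_dsum J M) r)" for r
    using vs by (simp add: pm_dsum_def dsum_module_vectorspace[OF R])
  show "pmap (pm_dsum J M) r s \<in> LinearCombinations.module_hom R (pspace (pm_dsum J M) r) (pspace (pm_dsum J M) s)"
    if rs: "r \<le> s" for r s
  proof -
    have hom: "mod_hom R (pspace (M j) r) (pspace (M j) s) (pmap (M j) r s)" if "j \<in> J" for j
      using vs[OF that] persistence_module.map_hom[OF M[OF that] rs]
      by (auto simp: mod_hom_def mod_hom_axioms_def vectorspace_def)
    have fin: "finite {j \<in> J. pmap (M j) r s (x j) \<noteq> \<zero>\<^bsub>pspace (M j) s\<^esub>}"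
      if "finite {j \<in> J. x j \<noteq> \<zero>\<^bsub>pspace (M j) r\<^esub>}" for x
      by (rule finite_subset[OF _ that]) (auto simp: mod_hom.f0_is_0[OF hom])
    show ?thesis
      using fin
      by (auto simp: LinearCombinations.module_hom_def pm_dsum_def dsum_module_def PiE_iff fun_eq_iff
          mod_hom.f_im[OF hom] LinearCombinations.module_hom_add[OF mod_hom.f_hom[OF hom]] LinearCombinations.module_hom_smult[OF mod_hom.f_hom[OF hom]]
          cong: conj_cong)
  qed
  show "pmap (pm_dsum J M) r r x = x" if "x \<in> carrier (pspace (pm_dsum J M) r)" for x r
    using that persistence_module.map_id[OF M]
    by (auto simp: pm_dsum_def dsum_module_def PiE_iff fun_eq_iff extensional_def)
  show "pmap (pm_dsum J M) s t (pmap (pm_dsum J M) r s x) = pmap (pm_dsum J M) r t x"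
    if "r \<le> s" "s \<le> t" "x \<in> carrier (pspace (pm_dsum J M) r)" for x r s t
    using that persistence_module.map_comp[OF M]
    by (auto simp: pm_dsum_def dsum_module_def PiE_iff fun_eq_iff)
qed

section \<open>Barcode bases\<close>

locale barcode =
  fixes R :: "'f ring" and G :: "('f, 'g) pmod" and m :: nat and a b :: "nat \<Rightarrow> real"
    and g :: "nat \<Rightarrow> real \<Rightarrow> 'f \<Rightarrow> 'g"
  assumes vectorspace_G: "vectorspace R (pspace G r)"
    and basis: "barcode_basis R G {1..m} a b g"
begin

declare One_nat_def [simp del]

definition active :: "real \<Rightarrow> nat set" where
  "active r = {i \<in> {1..m}. r \<in> {a i..<b i}}"

abbreviation "gen \<equiv> barcode_gen R G a b g"
abbreviation "coord \<equiv> barcode_coord R G m a b g"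
abbreviation "bars \<equiv> pm_dsum {1..m} (\<lambda>i. interval_pm R (a i) (b i))"

lemma finite_active [simp]: "finite (active r)"
  by (simp add: active_def)

lemma interval_carrier:
  "carrier (pspace (interval_pm R c d) r) = (if r \<in> {c..<d} then carrier R else {\<zero>\<^bsub>R\<^esub>})"
  by (simp add: interval_pm_def)

lemma R_field: "field R"
  using vectorspace_G vectorspace_def by blast

text \<open>The index set is finite, so finite support is automatic, and a bar contributes the field
  if it contains r and zero otherwise. An element of the sum at r therefore amounts to a family of
  scalars on \<open>active r\<close>.\<close>

lemma bars_carrier:
  "c \<in> carrier (pspace bars r) \<longleftrightarrow> c \<in> extensional {1..m} \<and>
    (\<forall>i\<in>active r. c i \<in> carrier R) \<and> (\<forall>i\<in>{1..m} - active r. c i = \<zero>\<^bsub>R\<^esub>)"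
proof -
  have act: "active r \<subseteq> {1..m}"
    by (auto simp: active_def)
  have int: "carrier (pspace (interval_pm R (a i) (b i)) r) = (if i \<in> active r then carrier R else {\<zero>\<^bsub>R\<^esub>})"
    if "i \<in> {1..m}" for i
    using that by (simp add: interval_carrier active_def)
  have "c \<in> carrier (pspace bars r) \<longleftrightarrow> c \<in> extensional {1..m} \<and>
      (\<forall>i\<in>{1..m}. c i \<in> carrier (pspace (interval_pm R (a i) (b i)) r))"
    by (simp add: pm_dsum_def dsum_module_def PiE_iff conj_commute)
  also have "\<dots> \<longleftrightarrow> c \<in> extensional {1..m} \<and>
      (\<forall>i\<in>{1..m}. c i \<in> (if i \<in> active r then carrier R else {\<zero>\<^bsub>R\<^esub>}))"
    using int by (metis (no_types, lifting))
  finally show ?thesis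
    using act by (smt (verit) DiffE DiffI singletonD singletonI subsetD)
qed

lemma gen_closed:
  assumes "i \<in> {1..m}"
  shows "gen i r \<in> carrier (pspace G r)"
proof -
  interpret G: vectorspace R "pspace G r" by (rule vectorspace_G)
  have "g i r \<in> LinearCombinations.module_hom R (pspace (interval_pm R (a i) (b i)) r) (pspace G r)"
    using basis assms by (auto simp: barcode_basis_def pm_hom_def)
  then show ?thesis
    by (auto simp: barcode_gen_def LinearCombinations.module_hom_def interval_carrier Pi_iff)
qed

text \<open>At an active r the interval module is the field itself, so \<open>c i\<close> is
  \<open>c i\<close> times the unit and linearity of \<open>g i r\<close> produces a multiple of the
  generator. Active indices with coordinate zero, which \<open>dsum_sum\<close> leaves out,
  contribute nothing.\<close>

lemma dsum_sum_eq:
  assumes c: "c \<in> carrier (pspace bars r)"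
  shows "dsum_sum {1..m} (\<lambda>i. interval_pm R (a i) (b i)) G g r c =
    (\<Oplus>\<^bsub>pspace G r\<^esub>i\<in>active r. c i \<odot>\<^bsub>pspace G r\<^esub> gen i r)"
proof -
  interpret G: vectorspace R "pspace G r" by (rule vectorspace_G)
  have z: "\<zero>\<^bsub>pspace (interval_pm R (a i) (b i)) r\<^esub> = \<zero>\<^bsub>R\<^esub>" for i
    by (simp add: interval_pm_def)
  have act: "active r \<subseteq> {1..m}" by (auto simp: active_def)
  show ?thesis
    unfolding dsum_sum_def z
  proof (rule G.M.add.finprod_mono_neutral_cong_left)
    show "{i \<in> {1..m}. c i \<noteq> \<zero>\<^bsub>R\<^esub>} \<subseteq> active r"
      using c by (auto simp: bars_carrier)
    show "c i \<odot>\<^bsub>pspace G r\<^esub> gen i r = \<zero>\<^bsub>pspace G r\<^esub>" if "i \<in> active r - {i \<in> {1..m}. c i \<noteq> \<zero>\<^bsub>R\<^esub>}" for i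
      using that act gen_closed by auto
    show "(\<lambda>i. c i \<odot>\<^bsub>pspace G r\<^esub> gen i r) \<in> active r \<rightarrow> carrier (pspace G r)"
      using c act by (auto simp: bars_carrier intro!: gen_closed)
    fix i assume "i \<in> {i \<in> {1..m}. c i \<noteq> \<zero>\<^bsub>R\<^esub>}"
    then have i: "i \<in> {1..m}" "i \<in> active r" "c i \<in> carrier R"
      using c by (auto simp: bars_carrier)
    have "g i r \<in> LinearCombinations.module_hom R (pspace (interval_pm R (a i) (b i)) r) (pspace G r)"
      using basis i by (auto simp: barcode_basis_def pm_hom_def)
    moreover have "c i = c i \<odot>\<^bsub>pspace (interval_pm R (a i) (b i)) r\<^esub> \<one>\<^bsub>R\<^esub>"
      using i by (simp add: interval_pm_def)
    moreover have "\<one>\<^bsub>R\<^esub> \<in> carrier (pspace (interval_pm R (a i) (b i)) r)"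
      using i by (auto simp: interval_carrier active_def)
    ultimately have "g i r (c i) = c i \<odot>\<^bsub>pspace G r\<^esub> g i r \<one>\<^bsub>R\<^esub>"
      using i module_hom_smult by metis
    then show "g i r (c i) = c i \<odot>\<^bsub>pspace G r\<^esub> gen i r"
      using i by (simp add: barcode_gen_def active_def)
  qed simp
qed

lemma dsum_sum_bij:
  "bij_betw (dsum_sum {1..m} (\<lambda>i. interval_pm R (a i) (b i)) G g r) (carrier (pspace bars r)) (carrier (pspace G r))"
  using basis by (auto simp: barcode_basis_def pm_iso_def)

section \<open>Coordinates with respect to the active generators\<close>

lemma coord_bars: "x \<in> carrier (pspace G r) \<Longrightarrow> coord r x \<in> carrier (pspace bars r)"
  unfolding barcode_coord_def
  by (rule inv_into_into) (simp add: bij_betw_imp_surj_on[OF dsum_sum_bij])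

lemma coord_closed [simp]: "x \<in> carrier (pspace G r) \<Longrightarrow> i \<in> active r \<Longrightarrow> coord r x i \<in> carrier R"
  using coord_bars bars_carrier by blast

lemma coord_inactive: "x \<in> carrier (pspace G r) \<Longrightarrow> i \<in> {1..m} - active r \<Longrightarrow> coord r x i = \<zero>\<^bsub>R\<^esub>"
  using coord_bars bars_carrier by blast

lemma gen_expansion:
  assumes "x \<in> carrier (pspace G r)"
  shows "(\<Oplus>\<^bsub>pspace G r\<^esub>i\<in>active r. coord r x i \<odot>\<^bsub>pspace G r\<^esub> gen i r) = x"
  using dsum_sum_eq[OF coord_bars[OF assms]] bij_betw_inv_into_right[OF dsum_sum_bij assms]
  by (simp add: barcode_coord_def)

text \<open>Uniqueness of coordinates, that is, linear independence of the active generators;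
  \<open>gen_expansion\<close> is the spanning half. Both come from bijectivity of the barcode
  morphism at r.\<close>

lemma coord_finsum:
  assumes c: "c \<in> active r \<rightarrow> carrier R" and i: "i \<in> active r"
  shows "coord r (\<Oplus>\<^bsub>pspace G r\<^esub>i\<in>active r. c i \<odot>\<^bsub>pspace G r\<^esub> gen i r) i = c i"
proof -
  interpret G: vectorspace R "pspace G r" by (rule vectorspace_G)
  \<comment> \<open>The element of the sum of interval modules with active coordinates c: zero at
    inactive indices and undefined outside \<open>{1..m}\<close>, as \<open>bars_carrier\<close>
    demands.\<close>
  define c' where "c' = (\<lambda>i\<in>{1..m}. if i \<in> active r then c i else \<zero>\<^bsub>R\<^esub>)"
  have c': "c' i = c i" if "i \<in> active r" for i
    using that by (auto simp: c'_def active_def)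
  have "c' \<in> carrier (pspace bars r)"
    using c c' by (auto simp: bars_carrier) (auto simp: c'_def)
  then have "coord r (\<Oplus>\<^bsub>pspace G r\<^esub>i\<in>active r. c' i \<odot>\<^bsub>pspace G r\<^esub> gen i r) = c'"
    using bij_betw_inv_into_left[OF dsum_sum_bij] by (simp add: barcode_coord_def flip: dsum_sum_eq)
  moreover have "(\<Oplus>\<^bsub>pspace G r\<^esub>i\<in>active r. c' i \<odot>\<^bsub>pspace G r\<^esub> gen i r) = (\<Oplus>\<^bsub>pspace G r\<^esub>i\<in>active r. c i \<odot>\<^bsub>pspace G r\<^esub> gen i r)"
    by (rule finsum_fundef_cong) (auto simp: c')
  ultimately show ?thesis
    using c' i by simp
qed

lemma coord_gen:
  assumes "i \<in> active r" "j \<in> active r"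
  shows "coord r (gen i r) j = (if j = i then \<one>\<^bsub>R\<^esub> else \<zero>\<^bsub>R\<^esub>)"
proof -
  interpret G: vectorspace R "pspace G r" by (rule vectorspace_G)
  define c where "c = (\<lambda>j. if j = i then \<one>\<^bsub>R\<^esub> else \<zero>\<^bsub>R\<^esub>)"
  have "(\<Oplus>\<^bsub>pspace G r\<^esub>j\<in>active r. c j \<odot>\<^bsub>pspace G r\<^esub> gen j r) = gen i r"
    unfolding c_def using assms gen_closed by (intro G.finsum_smult_Kronecker) (auto simp: active_def)
  moreover have "c \<in> active r \<rightarrow> carrier R"
    by (auto simp: c_def)
  ultimately show ?thesis
    using coord_finsum[of c r j] assms by (simp only: c_def)
qed

lemma gen_smult_closed:
  assumes "c \<in> active r \<rightarrow> carrier R"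
  shows "(\<lambda>i. c i \<odot>\<^bsub>pspace G r\<^esub> gen i r) \<in> active r \<rightarrow> carrier (pspace G r)"
proof (rule Pi_I)
  interpret G: vectorspace R "pspace G r" by (rule vectorspace_G)
  fix i assume i: "i \<in> active r"
  then have "i \<in> {1..m}"
    by (simp add: active_def)
  then show "c i \<odot>\<^bsub>pspace G r\<^esub> gen i r \<in> carrier (pspace G r)"
    using i assms by (intro G.smult_closed gen_closed) auto
qed

text \<open>\<open>coord\<close> is a set-theoretic inverse, so its linearity has to be recovered:
  expand both vectors in the generators, collect coefficients, and read them off by
  uniqueness.\<close>

lemma coord_add:
  assumes "x \<in> carrier (pspace G r)" "y \<in> carrier (pspace G r)" "i \<in> active r"
  shows "coord r (x \<oplus>\<^bsub>pspace G r\<^esub> y) i = coord r x i \<oplus>\<^bsub>R\<^esub> coord r y i"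
proof -
  interpret G: vectorspace R "pspace G r" by (rule vectorspace_G)
  have "x \<oplus>\<^bsub>pspace G r\<^esub> y =
      (\<Oplus>\<^bsub>pspace G r\<^esub>i\<in>active r. (coord r x i \<odot>\<^bsub>pspace G r\<^esub> gen i r) \<oplus>\<^bsub>pspace G r\<^esub> (coord r y i \<odot>\<^bsub>pspace G r\<^esub> gen i r))"
    using assms by (simp add: G.M.finsum_addf gen_smult_closed gen_expansion)
  also have "\<dots> = (\<Oplus>\<^bsub>pspace G r\<^esub>i\<in>active r. (coord r x i \<oplus>\<^bsub>R\<^esub> coord r y i) \<odot>\<^bsub>pspace G r\<^esub> gen i r)"
    using assms gen_closed by (intro finsum_fundef_cong) (auto simp: active_def G.smult_l_distr)
  finally show ?thesis
    using assms by (simp add: coord_finsum)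
qed

lemma coord_smult:
  assumes "x \<in> carrier (pspace G r)" "c \<in> carrier R" "i \<in> active r"
  shows "coord r (c \<odot>\<^bsub>pspace G r\<^esub> x) i = c \<otimes>\<^bsub>R\<^esub> coord r x i"
proof -
  interpret G: vectorspace R "pspace G r" by (rule vectorspace_G)
  have "c \<odot>\<^bsub>pspace G r\<^esub> x = c \<odot>\<^bsub>pspace G r\<^esub> (\<Oplus>\<^bsub>pspace G r\<^esub>i\<in>active r. coord r x i \<odot>\<^bsub>pspace G r\<^esub> gen i r)"
    using assms by (simp add: gen_expansion)
  also have "\<dots> = (\<Oplus>\<^bsub>pspace G r\<^esub>i\<in>active r. c \<odot>\<^bsub>pspace G r\<^esub> (coord r x i \<odot>\<^bsub>pspace G r\<^esub> gen i r))"
    using assms by (intro G.finsum_smult_ldistr) (auto simp: gen_smult_closed)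
  also have "\<dots> = (\<Oplus>\<^bsub>pspace G r\<^esub>i\<in>active r. (c \<otimes>\<^bsub>R\<^esub> coord r x i) \<odot>\<^bsub>pspace G r\<^esub> gen i r)"
    using assms gen_closed by (intro finsum_fundef_cong) (auto simp: active_def G.smult_assoc1)
  finally show ?thesis
    using assms by (simp add: coord_finsum)
qed

section \<open>Linear extension from the active generators\<close>

lemma extend_eq:
  "barcode_extend R G m a b g r W h x = (\<Oplus>\<^bsub>W\<^esub>i\<in>active r. coord r x i \<odot>\<^bsub>W\<^esub> h i)"
  by (simp add: barcode_extend_def active_def)

lemma extend_hom:
  assumes W: "vectorspace R W" and h: "h \<in> active r \<rightarrow> carrier W"
  shows "barcode_extend R G m a b g r W h \<in> LinearCombinations.module_hom R (pspace G r) W"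
proof -
  interpret W: vectorspace R W by (rule W)
  interpret G: vectorspace R "pspace G r" by (rule vectorspace_G)
  have cl: "(\<lambda>i. coord r x i \<odot>\<^bsub>W\<^esub> h i) \<in> active r \<rightarrow> carrier W" if "x \<in> carrier (pspace G r)" for x
    using that h by (auto simp: Pi_iff)
  have "barcode_extend R G m a b g r W h (x \<oplus>\<^bsub>pspace G r\<^esub> y) =
      barcode_extend R G m a b g r W h x \<oplus>\<^bsub>W\<^esub> barcode_extend R G m a b g r W h y"
    if "x \<in> carrier (pspace G r)" "y \<in> carrier (pspace G r)" for x y
  proof -
    have "barcode_extend R G m a b g r W h (x \<oplus>\<^bsub>pspace G r\<^esub> y) =
        (\<Oplus>\<^bsub>W\<^esub>i\<in>active r. coord r x i \<odot>\<^bsub>W\<^esub> h i \<oplus>\<^bsub>W\<^esub> coord r y i \<odot>\<^bsub>W\<^esub> h i)"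
      unfolding extend_eq
      using that h by (intro finsum_fundef_cong) (auto simp: coord_add W.smult_l_distr Pi_iff)
    then show ?thesis
      using that by (simp add: extend_eq W.M.finsum_addf cl)
  qed
  moreover have "barcode_extend R G m a b g r W h (c \<odot>\<^bsub>pspace G r\<^esub> x) =
      c \<odot>\<^bsub>W\<^esub> barcode_extend R G m a b g r W h x"
    if "x \<in> carrier (pspace G r)" "c \<in> carrier R" for x c
    unfolding extend_eq using that h
    by (subst W.finsum_smult_ldistr) (auto intro!: finsum_fundef_cong simp: cl coord_smult W.smult_assoc1 Pi_iff)
  moreover have "barcode_extend R G m a b g r W h x \<in> carrier W" if "x \<in> carrier (pspace G r)" for x
    unfolding extend_eq using that by (intro W.M.finsum_closed cl)
  ultimately show ?thesis
    by (simp add: LinearCombinations.module_hom_def)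
qed

lemma extend_gen:
  assumes W: "vectorspace R W" and h: "h \<in> active r \<rightarrow> carrier W" and i: "i \<in> active r"
  shows "barcode_extend R G m a b g r W h (gen i r) = h i"
proof -
  interpret W: vectorspace R W by (rule W)
  have "barcode_extend R G m a b g r W h (gen i r) =
      (\<Oplus>\<^bsub>W\<^esub>j\<in>active r. (if j = i then \<one>\<^bsub>R\<^esub> else \<zero>\<^bsub>R\<^esub>) \<odot>\<^bsub>W\<^esub> h j)"
    unfolding extend_eq using i by (intro finsum_fundef_cong) (auto simp: coord_gen)
  then show ?thesis
    using W.finsum_smult_Kronecker[of "active r" i h] i h by simp
qed

lemma hom_eqI:
  assumes W: "vectorspace R W"
    and f: "f \<in> LinearCombinations.module_hom R (pspace G r) W"
    and h: "h \<in> LinearCombinations.module_hom R (pspace G r) W"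
    and eq: "\<And>i. i \<in> active r \<Longrightarrow> f (gen i r) = h (gen i r)"
    and x: "x \<in> carrier (pspace G r)"
  shows "f x = h x"
proof -
  interpret W: vectorspace R W by (rule W)
  interpret G: vectorspace R "pspace G r" by (rule vectorspace_G)
  have *: "f' x = (\<Oplus>\<^bsub>W\<^esub>i\<in>active r. coord r x i \<odot>\<^bsub>W\<^esub> f' (gen i r))"
    if "f' \<in> LinearCombinations.module_hom R (pspace G r) W" for f'
  proof -
    interpret mod_hom R "pspace G r" W f'
      using that by unfold_locales
    have "f' x = f' (\<Oplus>\<^bsub>pspace G r\<^esub>i\<in>active r. coord r x i \<odot>\<^bsub>pspace G r\<^esub> gen i r)"
      using x by (simp add: gen_expansion)
    also have "\<dots> = (\<Oplus>\<^bsub>W\<^esub>i\<in>active r. f' (coord r x i \<odot>\<^bsub>pspace G r\<^esub> gen i r))"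
      using x by (intro hom_finsum) (auto simp: gen_smult_closed)
    also have "\<dots> = (\<Oplus>\<^bsub>W\<^esub>i\<in>active r. coord r x i \<odot>\<^bsub>W\<^esub> f' (gen i r))"
      using x gen_closed by (intro finsum_fundef_cong) (auto simp: active_def)
    finally show ?thesis .
  qed
  show ?thesis
    unfolding *[OF f] *[OF h] by (intro finsum_fundef_cong) (auto simp: eq)
qed

end

section \<open>Lifts of barcode generators\<close>

text \<open>This is what remains of the filtration once bases have been lifted: at every r the
  transported lifts of the active generators form a basis of V r. The comparison of the new module
  with V is carried out from this alone.\<close>

locale barcode_lift = barcode R G m a b g
  for R :: "'f ring" and G :: "('f, 'g) pmod" and m a b g +
  fixes V :: "('f, 'v) pmod" and l :: "nat \<Rightarrow> 'v"
  assumes persistence_V: "persistence_module R V"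
    and l_closed: "i \<in> {1..m} \<Longrightarrow> l i \<in> carrier (pspace V (a i))"
    and lift_independent: "c \<in> active r \<rightarrow> carrier R \<Longrightarrow>
      (\<Oplus>\<^bsub>pspace V r\<^esub>i\<in>active r. c i \<odot>\<^bsub>pspace V r\<^esub> pmap V (a i) r (l i)) = \<zero>\<^bsub>pspace V r\<^esub> \<Longrightarrow>
      i \<in> active r \<Longrightarrow> c i = \<zero>\<^bsub>R\<^esub>"
    and lift_spanning: "x \<in> carrier (pspace V r) \<Longrightarrow> \<exists>c\<in>active r \<rightarrow> carrier R.
      x = (\<Oplus>\<^bsub>pspace V r\<^esub>i\<in>active r. c i \<odot>\<^bsub>pspace V r\<^esub> pmap V (a i) r (l i))"
begin

abbreviation "lift \<equiv> lift_map R G V m a b g l"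
abbreviation "tcoeff \<equiv> tilde_coeff R G V m a b g l"
abbreviation "tgen \<equiv> tilde_gen R G V m a b g l"
abbreviation "tilde \<equiv> tilde_pm R G V m a b g l"

lemma vectorspace_V: "vectorspace R (pspace V r)"
  by (rule persistence_module.vectorspace[OF persistence_V])

lemma pmap_V_hom: "r \<le> s \<Longrightarrow> pmap V r s \<in> LinearCombinations.module_hom R (pspace V r) (pspace V s)"
  by (rule persistence_module.map_hom[OF persistence_V])

lemma pmap_V_closed: "r \<le> s \<Longrightarrow> x \<in> carrier (pspace V r) \<Longrightarrow> pmap V r s x \<in> carrier (pspace V s)"
  using module_hom_closed[OF pmap_V_hom] by blast

lemma pmap_V_comp:
  "r \<le> s \<Longrightarrow> s \<le> t \<Longrightarrow> x \<in> carrier (pspace V r) \<Longrightarrow> pmap V s t (pmap V r s x) = pmap V r t x"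
  by (rule persistence_module.map_comp[OF persistence_V])

lemma lifted_closed: "(\<lambda>i. pmap V (a i) r (l i)) \<in> active r \<rightarrow> carrier (pspace V r)"
  by (auto simp: active_def intro!: pmap_V_closed l_closed)

lemma lift_hom: "lift r \<in> LinearCombinations.module_hom R (pspace G r) (pspace V r)"
  unfolding lift_map_def by (rule extend_hom[OF vectorspace_V lifted_closed])

lemma lift_gen: "i \<in> active r \<Longrightarrow> lift r (gen i r) = pmap V (a i) r (l i)"
  unfolding lift_map_def by (simp add: extend_gen[OF vectorspace_V lifted_closed])

text \<open>A basis goes to a basis: independence of the transported lifts makes the kernel trivial,
  and their spanning gives surjectivity.\<close>

lemma lift_bij: "bij_betw (lift r) (carrier (pspace G r)) (carrier (pspace V r))"
proof -
  interpret V: vectorspace R "pspace V r" by (rule vectorspace_V)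
  interpret G: vectorspace R "pspace G r" by (rule vectorspace_G)
  interpret mod_hom R "pspace G r" "pspace V r" "lift r"
    using lift_hom by unfold_locales
  have zero: "x = \<zero>\<^bsub>pspace G r\<^esub>" if x: "x \<in> carrier (pspace G r)" "lift r x = \<zero>\<^bsub>pspace V r\<^esub>" for x
  proof -
    have "coord r x i = \<zero>\<^bsub>R\<^esub>" if "i \<in> active r" for i
      by (rule lift_independent[OF _ _ that]) (use x in \<open>auto simp: lift_map_def extend_eq\<close>)
    then have "x = (\<Oplus>\<^bsub>pspace G r\<^esub>i\<in>active r. \<zero>\<^bsub>R\<^esub> \<odot>\<^bsub>pspace G r\<^esub> gen i r)"
      by (subst gen_expansion[OF x(1), symmetric]) (intro finsum_fundef_cong, auto)
    also have "\<dots> = (\<Oplus>\<^bsub>pspace G r\<^esub>i\<in>active r. \<zero>\<^bsub>pspace G r\<^esub>)"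
      using gen_closed by (intro finsum_fundef_cong) (auto simp: active_def)
    finally show ?thesis by simp
  qed
  have "x = y" if "x \<in> carrier (pspace G r)" "y \<in> carrier (pspace G r)" "lift r x = lift r y" for x y
  proof -
    have "lift r (x \<ominus>\<^bsub>pspace G r\<^esub> y) = \<zero>\<^bsub>pspace V r\<^esub>"
      using that by (simp add: a_minus_def V.M.r_neg)
    then have *: "x \<ominus>\<^bsub>pspace G r\<^esub> y = \<zero>\<^bsub>pspace G r\<^esub>"
      using that zero by simp
    have "x = (x \<ominus>\<^bsub>pspace G r\<^esub> y) \<oplus>\<^bsub>pspace G r\<^esub> y"
      using that by (simp add: a_minus_def G.M.a_assoc G.M.l_neg)
    then show ?thesis
      using that * by simp
  qed
  then have "inj_on (lift r) (carrier (pspace G r))"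
    by (auto intro: inj_onI)
  moreover have "x \<in> lift r ` carrier (pspace G r)" if x: "x \<in> carrier (pspace V r)" for x
  proof -
    obtain c where c: "c \<in> active r \<rightarrow> carrier R"
      "x = (\<Oplus>\<^bsub>pspace V r\<^esub>i\<in>active r. c i \<odot>\<^bsub>pspace V r\<^esub> pmap V (a i) r (l i))"
      using lift_spanning[OF x] by blast
    define y where "y = (\<Oplus>\<^bsub>pspace G r\<^esub>i\<in>active r. c i \<odot>\<^bsub>pspace G r\<^esub> gen i r)"
    have "y \<in> carrier (pspace G r)"
      unfolding y_def by (intro G.M.finsum_closed gen_smult_closed c)
    moreover have "lift r y = x"
      unfolding c(2) lift_map_def extend_eq
      by (intro finsum_fundef_cong) (auto simp: y_def coord_finsum c(1))
    ultimately show ?thesis by blast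
  qed
  ultimately show ?thesis
    using f_im by (auto simp: bij_betw_def)
qed

text \<open>Applying the lift map at b i undoes the inverse in the definition of the coefficients,
  which leaves an identity inside V. The last part is the convention c_ij = 0 for bars that do not
  contain b i; it holds because coordinates are taken in the sum of interval modules.\<close>

lemma coeff_expansion:
  assumes i: "i \<in> {1..m}"
  shows "(\<Oplus>\<^bsub>pspace V (b i)\<^esub>j\<in>active (b i). tcoeff i j \<odot>\<^bsub>pspace V (b i)\<^esub> pmap V (a j) (b i) (l j)) =
      pmap V (a i) (b i) (l i)"
    and "j \<in> active (b i) \<Longrightarrow> tcoeff i j \<in> carrier R"
    and "j \<in> {1..m} - active (b i) \<Longrightarrow> tcoeff i j = \<zero>\<^bsub>R\<^esub>"
proof -
  have ab: "a i < b i" and act: "i \<in> active (a i)"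
    using basis i by (auto simp: barcode_basis_def active_def)
  \<comment> \<open>At a i the structure map of V is the identity, so the lift map returns the
    chosen lift itself.\<close>
  have "lift (a i) (gen i (a i)) = l i"
    using lift_gen[OF act] l_closed[OF i] persistence_V by (simp add: persistence_module.map_id)
  then have eq: "tcoeff i = coord (b i) (inv_into (carrier (pspace G (b i))) (lift (b i)) (pmap V (a i) (b i) (l i)))"
    by (simp add: tilde_coeff_def)
  have v: "pmap V (a i) (b i) (l i) \<in> carrier (pspace V (b i))"
    using ab i by (intro pmap_V_closed l_closed) auto
  define y where "y = inv_into (carrier (pspace G (b i))) (lift (b i)) (pmap V (a i) (b i) (l i))"
  have eq': "tcoeff i = coord (b i) y"
    by (simp add: eq y_def)
  have y: "y \<in> carrier (pspace G (b i))" "lift (b i) y = pmap V (a i) (b i) (l i)"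
    using v lift_bij[of "b i"] unfolding y_def
    by (auto simp: bij_betw_inv_into_right) (metis bij_betw_def inv_into_into)
  show "(\<Oplus>\<^bsub>pspace V (b i)\<^esub>j\<in>active (b i). tcoeff i j \<odot>\<^bsub>pspace V (b i)\<^esub> pmap V (a j) (b i) (l j)) =
      pmap V (a i) (b i) (l i)"
    using y(2) by (simp add: lift_map_def extend_eq eq')
  show "j \<in> active (b i) \<Longrightarrow> tcoeff i j \<in> carrier R"
    "j \<in> {1..m} - active (b i) \<Longrightarrow> tcoeff i j = \<zero>\<^bsub>R\<^esub>"
    using y(1) by (auto simp: eq' coord_inactive)
qed

lemma coeff_closed: "i \<in> {1..m} \<Longrightarrow> j \<in> {1..m} \<Longrightarrow> tcoeff i j \<in> carrier R"
  using coeff_expansion(2,3)[of i j] R_field by (cases "j \<in> active (b i)") (auto dest: fieldE(1) cring.cring_simprules)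

text \<open>The remaining branch of the recursion is zero, so closure holds for all r and s, in
  either order. Hence the maps of the new module are linear between any two of its spaces.\<close>

lemma tgen_closed:
  assumes "i \<in> {1..m}"
  shows "tgen r s i \<in> carrier (pspace G s)"
  using assms
proof (induction r s i rule: tilde_gen.induct[where m = m and a = a and b = b])
  case (1 r s i)
  interpret G: vectorspace R "pspace G s" by (rule vectorspace_G)
  show ?case
    using 1 coeff_closed gen_closed
    by (subst tilde_gen.simps) (auto intro!: G.M.finsum_closed)
qed

text \<open>For a bar active at r and r \<le> s only two branches of the recursion occur. If s is
  still before b i, the value is a generator and its lift is known. Otherwise the transport in V is
  broken at b i, where the coefficients re-expand the lift.\<close>

lemma lift_tgen:
  assumes "i \<in> active r" "r \<le> s"
  shows "lift s (tgen r s i) = pmap V (a i) s (l i)"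
  using assms
proof (induction r s i rule: tilde_gen.induct[where m = m and a = a and b = b])
  case (1 r s i)
  then have i: "i \<in> {1..m}" "r \<in> {a i..<b i}" by (auto simp: active_def)
  interpret G: vectorspace R "pspace G s" by (rule vectorspace_G)
  interpret V: vectorspace R "pspace V s" by (rule vectorspace_V)
  interpret mod_hom R "pspace G s" "pspace V s" "lift s"
    using lift_hom by unfold_locales
  show ?case
  proof (cases "b i \<le> s")
    case False
    then have "i \<in> active s" "tgen r s i = gen i s"
      using i 1(3) by (auto simp: active_def tilde_gen.simps)
    then show ?thesis
      using lift_gen by simp
  next
    case True
    have act: "active (b i) \<subseteq> {1..m}" by (auto simp: active_def)
    interpret W: vectorspace R "pspace V (b i)" by (rule vectorspace_V)
    interpret bs: mod_hom R "pspace V (b i)" "pspace V s" "pmap V (b i) s"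
      using pmap_V_hom[OF True] by unfold_locales
    have "lift s (tgen r s i) = lift s (\<Oplus>\<^bsub>pspace G s\<^esub>j\<in>{1..m}. tcoeff i j \<odot>\<^bsub>pspace G s\<^esub> tgen (b i) s j)"
      using i True by (subst tilde_gen.simps) simp
    also have "\<dots> = (\<Oplus>\<^bsub>pspace V s\<^esub>j\<in>{1..m}. lift s (tcoeff i j \<odot>\<^bsub>pspace G s\<^esub> tgen (b i) s j))"
      using i by (intro hom_finsum) (auto intro!: coeff_closed tgen_closed)
    also have "\<dots> = (\<Oplus>\<^bsub>pspace V s\<^esub>j\<in>{1..m}. tcoeff i j \<odot>\<^bsub>pspace V s\<^esub> lift s (tgen (b i) s j))"
      using i by (intro finsum_fundef_cong) (auto simp: coeff_closed tgen_closed)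
    \<comment> \<open>The induction hypothesis speaks of bars that contain b i; the other summands
      have coefficient zero.\<close>
    also have "\<dots> = (\<Oplus>\<^bsub>pspace V s\<^esub>j\<in>active (b i). tcoeff i j \<odot>\<^bsub>pspace V s\<^esub> lift s (tgen (b i) s j))"
      using i act by (intro V.M.add.finprod_mono_neutral_cong_right)
        (auto simp: coeff_closed tgen_closed coeff_expansion(3))
    \<comment> \<open>Each transported lift is factored through V (b i), so that the structure map
      from b i to s can be pulled out of the sum and the identity defining the coefficients applies
      inside.\<close>
    also have "\<dots> = (\<Oplus>\<^bsub>pspace V s\<^esub>j\<in>active (b i). pmap V (b i) s (tcoeff i j \<odot>\<^bsub>pspace V (b i)\<^esub> pmap V (a j) (b i) (l j)))"
    proof (intro finsum_fundef_cong refl)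
      fix j assume j: "j \<in> active (b i)"
      then have "lift s (tgen (b i) s j) = pmap V (a j) s (l j)"
        using 1(1)[of j] i True act by auto
      also have "\<dots> = pmap V (b i) s (pmap V (a j) (b i) (l j))"
        using j True act l_closed[of j] by (subst pmap_V_comp) (auto simp: active_def)
      finally show "tcoeff i j \<odot>\<^bsub>pspace V s\<^esub> lift s (tgen (b i) s j) =
          pmap V (b i) s (tcoeff i j \<odot>\<^bsub>pspace V (b i)\<^esub> pmap V (a j) (b i) (l j))"
        using coeff_expansion(2)[OF i(1) j] lifted_closed[of "b i"] j by (auto simp: Pi_iff)
    qed
    also have "\<dots> = pmap V (b i) s (pmap V (a i) (b i) (l i))"
      unfolding coeff_expansion(1)[OF i(1), symmetric]
      using coeff_expansion(2)[OF i(1)] lifted_closed[of "b i"]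
      by (intro bs.hom_finsum[symmetric]) (auto simp: Pi_iff)
    also have "\<dots> = pmap V (a i) s (l i)"
      using i True l_closed[of i] by (subst pmap_V_comp) auto
    finally show ?thesis .
  qed
qed

section \<open>Naturality of the lift maps\<close>

lemma pmap_tilde_hom: "pmap tilde r s \<in> LinearCombinations.module_hom R (pspace G r) (pspace G s)"
  using tgen_closed by (auto simp: tilde_pm_def active_def intro!: extend_hom vectorspace_G)

lemma lift_natural:
  assumes rs: "r \<le> s" and x: "x \<in> carrier (pspace G r)"
  shows "lift s (pmap tilde r s x) = pmap V r s (lift r x)"
proof (rule hom_eqI[OF vectorspace_V _ _ _ x])
  show "(\<lambda>x. lift s (pmap tilde r s x)) \<in> LinearCombinations.module_hom R (pspace G r) (pspace V s)"
    by (rule module_hom_comp[OF pmap_tilde_hom lift_hom])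
  show "(\<lambda>x. pmap V r s (lift r x)) \<in> LinearCombinations.module_hom R (pspace G r) (pspace V s)"
    by (rule module_hom_comp[OF lift_hom pmap_V_hom[OF rs]])
  fix i assume i: "i \<in> active r"
  have "pmap tilde r s (gen i r) = tgen r s i"
    using tgen_closed i by (auto simp: tilde_pm_def active_def intro!: extend_gen vectorspace_G)
  moreover have "pmap V r s (lift r (gen i r)) = pmap V (a i) s (l i)"
    using i rs l_closed by (simp add: lift_gen pmap_V_comp active_def)
  ultimately show "lift s (pmap tilde r s (gen i r)) = pmap V r s (lift r (gen i r))"
    using lift_tgen[OF i rs] by simp
qed

theorem tilde_isomorphic: "pm_isomorphic R tilde V"
proof -
  have G: "pspace tilde = pspace G"
    by (simp add: tilde_pm_def)
  \<comment> \<open>An identity in G is checked after applying the injective lift map, where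
    naturality turns it into the corresponding identity in V.\<close>
  have inj: "x = y" if "lift r x = lift r y" "x \<in> carrier (pspace G r)" "y \<in> carrier (pspace G r)" for x y r
    using lift_bij[of r] that by (meson bij_betw_imp_inj_on inj_onD)
  note cl = module_hom_closed[OF pmap_tilde_hom, THEN funcset_mem]
  note cl_V = module_hom_closed[OF lift_hom, THEN funcset_mem]
  interpret V: persistence_module R V by (rule persistence_V)
  have "persistence_module R tilde"
  proof (rule persistence_module.intro, unfold G)
    show "vectorspace R (pspace G r)" for r by (rule vectorspace_G)
    show "pmap tilde r s \<in> LinearCombinations.module_hom R (pspace G r) (pspace G s)" for r s
      by (rule pmap_tilde_hom)
    show "pmap tilde r r x = x" if "x \<in> carrier (pspace G r)" for x r
      using that by (intro inj[of r]) (auto simp: lift_natural cl cl_V V.map_id)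
    show "pmap tilde s t (pmap tilde r s x) = pmap tilde r t x"
      if "r \<le> s" "s \<le> t" "x \<in> carrier (pspace G r)" for x r s t
      using that by (intro inj[of t]) (auto simp: lift_natural cl cl_V V.map_comp)
  qed
  moreover have "lift \<in> pm_iso R tilde V"
    using lift_hom lift_bij lift_natural by (auto simp: pm_iso_def pm_hom_def G)
  ultimately show ?thesis
    using persistence_V by (auto simp: pm_isomorphic_def)
qed

end

section \<open>Lifting bases from the associated graded space\<close>

locale filtered_space =
  fixes R :: "'f ring" and V :: "('f, 'v) module" and W :: "int \<Rightarrow> 'v set" and n :: nat
  assumes vectorspace_V: "vectorspace R V"
    and submodule_W: "LinearCombinations.submodule R (W \<kappa>) V"
    and W_mono: "\<kappa> \<le> \<kappa>' \<Longrightarrow> W \<kappa> \<subseteq> W \<kappa>'"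
    and W_bot: "W (-1) = {\<zero>\<^bsub>V\<^esub>}"
    and W_top: "W (int n) = carrier V"
begin

definition graded_part :: "int \<Rightarrow> ('f, 'v set) module" where
  "graded_part \<kappa> = quot_module (V\<lparr>carrier := W \<kappa>\<rparr>) (W (\<kappa> - 1))"

abbreviation "cls \<kappa> x \<equiv> W (\<kappa> - 1) +>\<^bsub>V\<^esub> x"
abbreviation "graded \<equiv> dsum_module {0..int n} graded_part"

text \<open>The principal symbol of x. The degree \<kappa> is an argument because the same x lies in
  several steps of the filtration; for x in W (\<kappa> - 1) the symbol in degree \<kappa> is
  zero.\<close>

definition symbol :: "int \<Rightarrow> 'v \<Rightarrow> int \<Rightarrow> 'v set" where
  "symbol \<kappa> x = (\<lambda>j\<in>{0..int n}. if j = \<kappa> then cls \<kappa> x else \<zero>\<^bsub>graded_part j\<^esub>)"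

sublocale V: vectorspace R V by (rule vectorspace_V)

lemma W_carrier: "x \<in> W \<kappa> \<Longrightarrow> x \<in> carrier V"
  using submodule.subset[OF submodule_W] by blast

lemma vectorspace_graded_part: "vectorspace R (graded_part \<kappa>)"
  unfolding graded_part_def
  by (intro quot_module_vectorspace submodule_W vectorspace_submodule vectorspace_V) (auto dest: W_carrier)

lemma vectorspace_graded: "vectorspace R graded"
  by (intro dsum_module_vectorspace vectorspace_graded_part V.field_axioms)

lemma graded_part_carrier: "carrier (graded_part \<kappa>) = cls \<kappa> ` W \<kappa>"
  by (simp add: graded_part_def quot_module_carrier)

lemma cls_add: "x \<in> carrier V \<Longrightarrow> y \<in> carrier V \<Longrightarrow> cls \<kappa> (x \<oplus>\<^bsub>V\<^esub> y) = cls \<kappa> x \<oplus>\<^bsub>graded_part \<kappa>\<^esub> cls \<kappa> y"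
  unfolding graded_part_def using quot_module_coset(1)[OF submodule_W _ _ V.R.one_closed] by simp

lemma cls_smult: "x \<in> carrier V \<Longrightarrow> c \<in> carrier R \<Longrightarrow> cls \<kappa> (c \<odot>\<^bsub>V\<^esub> x) = c \<odot>\<^bsub>graded_part \<kappa>\<^esub> cls \<kappa> x"
  unfolding graded_part_def using quot_module_coset(2)[OF submodule_W, of x x] by simp

lemma zero_graded_part: "\<zero>\<^bsub>graded_part \<kappa>\<^esub> = W (\<kappa> - 1)"
  by (simp add: graded_part_def quot_module_def)

lemma cls_zero_iff: "x \<in> carrier V \<Longrightarrow> cls \<kappa> x = \<zero>\<^bsub>graded_part \<kappa>\<^esub> \<longleftrightarrow> x \<in> W (\<kappa> - 1)"
  using submodule.coset_zero_iff[OF submodule_W] by (simp add: zero_graded_part)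

lemma symbol_closed:
  assumes "x \<in> W \<kappa>"
  shows "symbol \<kappa> x \<in> carrier graded"
proof -
  have "symbol \<kappa> x j \<in> carrier (graded_part j)" if "j \<in> {0..int n}" for j
  proof -
    interpret vectorspace R "graded_part j" by (rule vectorspace_graded_part)
    show ?thesis
      using that assms by (simp add: symbol_def graded_part_carrier[of \<kappa>])
  qed
  moreover have "symbol \<kappa> x \<in> extensional {0..int n}"
    by (simp add: symbol_def)
  moreover have "finite {j \<in> {0..int n}. symbol \<kappa> x j \<noteq> \<zero>\<^bsub>graded_part j\<^esub>}"
    by (rule finite_subset[OF _ finite_atLeastAtMost_int]) blast
  ultimately show ?thesis
    by (simp add: dsum_module_def PiE_iff)
qed

lemma eval_hom:
  assumes "j \<in> {0..int n}"
  shows "mod_hom R graded (graded_part j) (\<lambda>y. y j)"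
proof -
  interpret g: vectorspace R graded by (rule vectorspace_graded)
  interpret p: vectorspace R "graded_part j" by (rule vectorspace_graded_part)
  show ?thesis
    using assms by unfold_locales (auto simp: LinearCombinations.module_hom_def dsum_module_def)
qed

lemma graded_eqI:
  "x \<in> carrier graded \<Longrightarrow> y \<in> carrier graded \<Longrightarrow> (\<And>j. j \<in> {0..int n} \<Longrightarrow> x j = y j) \<Longrightarrow> x = y"
  by (rule PiE_ext[of x "{0..int n}" "\<lambda>j. carrier (graded_part j)"]) (simp_all add: dsum_module_def)

end

text \<open>The basis of the graded space is homogeneous: each member is the symbol of
  \<open>v i\<close> in the single degree \<open>k i\<close>. This is what permits separating a
  graded combination by degree.\<close>

locale filtered_space_lift = filtered_space R V W n
  for R :: "'f ring" and V :: "('f, 'v) module" and W n +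
  fixes J :: "'j set" and k :: "'j \<Rightarrow> int" and v :: "'j \<Rightarrow> 'v"
  assumes finite_J: "finite J"
    and k: "i \<in> J \<Longrightarrow> k i \<in> {0..int n}"
    and v: "i \<in> J \<Longrightarrow> v i \<in> W (k i)"
    and independent: "c \<in> J \<rightarrow> carrier R \<Longrightarrow>
      (\<Oplus>\<^bsub>graded\<^esub>i\<in>J. c i \<odot>\<^bsub>graded\<^esub> symbol (k i) (v i)) = \<zero>\<^bsub>graded\<^esub> \<Longrightarrow> i \<in> J \<Longrightarrow> c i = \<zero>\<^bsub>R\<^esub>"
    and spanning: "y \<in> carrier graded \<Longrightarrow> \<exists>c\<in>J \<rightarrow> carrier R.
      y = (\<Oplus>\<^bsub>graded\<^esub>i\<in>J. c i \<odot>\<^bsub>graded\<^esub> symbol (k i) (v i))"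
begin

definition comb :: "('j \<Rightarrow> 'f) \<Rightarrow> 'v" where
  "comb c = (\<Oplus>\<^bsub>V\<^esub>i\<in>J. c i \<odot>\<^bsub>V\<^esub> v i)"

definition gcomb :: "('j \<Rightarrow> 'f) \<Rightarrow> int \<Rightarrow> 'v set" where
  "gcomb c = (\<Oplus>\<^bsub>graded\<^esub>i\<in>J. c i \<odot>\<^bsub>graded\<^esub> symbol (k i) (v i))"

lemma gcomb_closed:
  assumes "c \<in> J \<rightarrow> carrier R"
  shows "gcomb c \<in> carrier graded"
proof -
  interpret g: vectorspace R graded by (rule vectorspace_graded)
  show ?thesis
    unfolding gcomb_def using assms v by (intro g.M.finsum_closed) (auto intro!: symbol_closed)
qed

lemma gcomb_eval:
  assumes c: "c \<in> J \<rightarrow> carrier R" and j: "j \<in> {0..int n}"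
  shows "gcomb c j = (\<Oplus>\<^bsub>graded_part j\<^esub>i\<in>J. c i \<odot>\<^bsub>graded_part j\<^esub> symbol (k i) (v i) j)"
proof -
  interpret mod_hom R graded "graded_part j" "\<lambda>y. y j" by (rule eval_hom[OF j])
  have "gcomb c j = (\<Oplus>\<^bsub>graded_part j\<^esub>i\<in>J. (c i \<odot>\<^bsub>graded\<^esub> symbol (k i) (v i)) j)"
    unfolding gcomb_def using c v by (intro hom_finsum finite_J) (auto intro!: symbol_closed)
  also have "\<dots> = (\<Oplus>\<^bsub>graded_part j\<^esub>i\<in>J. c i \<odot>\<^bsub>graded_part j\<^esub> symbol (k i) (v i) j)"
    using c v by (intro finsum_fundef_cong refl f_smult) (auto intro!: symbol_closed)
  finally show ?thesis .
qed

text \<open>The bridge between V and the graded space. With generators of degree above \<kappa>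
  absent, every term lies in W \<kappa>. Modulo W (\<kappa> - 1) the terms of lower degree vanish,
  and those of degree \<kappa> are multiples of their symbols.\<close>

lemma comb_cls:
  assumes c: "c \<in> J \<rightarrow> carrier R" and \<kappa>: "\<kappa> \<in> {0..int n}"
    and supp: "\<And>i. i \<in> J \<Longrightarrow> \<kappa> < k i \<Longrightarrow> c i = \<zero>\<^bsub>R\<^esub>"
  shows "comb c \<in> W \<kappa>" "cls \<kappa> (comb c) = gcomb c \<kappa>"
proof -
  interpret W: submodule R "W \<kappa>" V by (rule submodule_W)
  interpret Q: vectorspace R "graded_part \<kappa>" by (rule vectorspace_graded_part)
  have mem: "c i \<odot>\<^bsub>V\<^esub> v i \<in> W \<kappa>" if "i \<in> J" for i
    using that supp[of i] W_mono[of "k i" \<kappa>] v[OF that] c W_carrier[of "v i" "k i"]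
    by (cases "\<kappa> < k i") auto
  have symb: "symbol (k i) (v i) \<kappa> \<in> carrier (graded_part \<kappa>)" if "i \<in> J" for i
    using symbol_closed[OF v[OF that]] \<kappa> by (auto simp: dsum_module_def)
  have eq: "cls \<kappa> (c i \<odot>\<^bsub>V\<^esub> v i) = c i \<odot>\<^bsub>graded_part \<kappa>\<^esub> symbol (k i) (v i) \<kappa>" if i: "i \<in> J" for i
  proof (cases "\<kappa> < k i")
    case True
    then show ?thesis
      using i supp[of i] symb[OF i] cls_zero_iff[of "\<zero>\<^bsub>V\<^esub>" \<kappa>] submodule.zero_closed[OF submodule_W] W_carrier[OF v[OF i]] by simp
  next
    case False
    have "cls \<kappa> (v i) = symbol (k i) (v i) \<kappa>"
    proof (cases "k i = \<kappa>")
      case True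
      then show ?thesis using \<kappa> by (simp add: symbol_def)
    next
      case neq: False
      then have "v i \<in> W (\<kappa> - 1)"
        using False W_mono[of "k i" "\<kappa> - 1"] v[OF i] by auto
      then show ?thesis
        using neq \<kappa> cls_zero_iff[of "v i" \<kappa>] W_carrier by (auto simp: symbol_def)
    qed
    moreover have "c i \<in> carrier R" using c i by auto
    ultimately show ?thesis
      using cls_smult[OF W_carrier[OF v[OF i]], of "c i" \<kappa>] by simp
  qed
  have "(\<Oplus>\<^bsub>V\<^esub>i\<in>A. c i \<odot>\<^bsub>V\<^esub> v i) \<in> W \<kappa> \<and> cls \<kappa> (\<Oplus>\<^bsub>V\<^esub>i\<in>A. c i \<odot>\<^bsub>V\<^esub> v i) =
      (\<Oplus>\<^bsub>graded_part \<kappa>\<^esub>i\<in>A. c i \<odot>\<^bsub>graded_part \<kappa>\<^esub> symbol (k i) (v i) \<kappa>)" if "finite A" "A \<subseteq> J" for A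
    using that
  proof (induction A)
    case empty
    show ?case
      using cls_zero_iff[of "\<zero>\<^bsub>V\<^esub>" \<kappa>] submodule.zero_closed[OF submodule_W] by simp
  next
    case (insert i A)
    let ?f = "\<lambda>i. c i \<odot>\<^bsub>V\<^esub> v i" and ?h = "\<lambda>i. c i \<odot>\<^bsub>graded_part \<kappa>\<^esub> symbol (k i) (v i) \<kappa>"
    have cl: "?f \<in> A \<rightarrow> carrier V" "?f i \<in> carrier V"
      using insert.prems mem W_carrier by blast+
    have cl': "?h \<in> A \<rightarrow> carrier (graded_part \<kappa>)" "?h i \<in> carrier (graded_part \<kappa>)"
      using insert.prems symb c by (auto intro!: Q.smult_closed)
    have "finsum V ?f (insert i A) = ?f i \<oplus>\<^bsub>V\<^esub> finsum V ?f A"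
      by (rule V.M.finsum_insert) (use insert.hyps cl in auto)
    moreover have "finsum (graded_part \<kappa>) ?h (insert i A) = ?h i \<oplus>\<^bsub>graded_part \<kappa>\<^esub> finsum (graded_part \<kappa>) ?h A"
      by (rule Q.M.finsum_insert) (use insert.hyps cl' in auto)
    ultimately show ?case
      using insert mem eq[of i] cl cls_add[of "?f i" "finsum V ?f A" \<kappa>] W_carrier by simp
  qed
  from this[OF finite_J order_refl] show "comb c \<in> W \<kappa>" "cls \<kappa> (comb c) = gcomb c \<kappa>"
    by (simp_all add: comb_def gcomb_eval[OF c \<kappa>])
qed

(* Cutting a combination down to the generators of degree kappa reduces both independence and
   spanning from degree kappa to degree kappa - 1. *)
definition truncate :: "int \<Rightarrow> ('j \<Rightarrow> 'f) \<Rightarrow> 'j \<Rightarrow> 'f" where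
  "truncate \<kappa> c i = (if k i = \<kappa> then c i else \<zero>\<^bsub>R\<^esub>)"

lemma truncate_closed: "c \<in> J \<rightarrow> carrier R \<Longrightarrow> truncate \<kappa> c \<in> J \<rightarrow> carrier R"
  by (auto simp: truncate_def)

text \<open>The symbol of \<open>v i\<close> has its only possibly nonzero coordinate in degree
  \<open>k i\<close>, so truncating coefficients to degree \<kappa> amounts to projecting onto the
  \<kappa>-th summand.\<close>

lemma gcomb_truncate:
  assumes c: "c \<in> J \<rightarrow> carrier R" and j: "j \<in> {0..int n}"
  shows "gcomb (truncate \<kappa> c) j = (if j = \<kappa> then gcomb c j else \<zero>\<^bsub>graded_part j\<^esub>)"
proof -
  interpret Q: vectorspace R "graded_part j" by (rule vectorspace_graded_part)
  have symb: "symbol (k i) (v i) j \<in> carrier (graded_part j)" if "i \<in> J" for i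
    using symbol_closed[OF v[OF that]] j by (auto simp: dsum_module_def)
  have other: "symbol (k i) (v i) j = \<zero>\<^bsub>graded_part j\<^esub>" if "k i \<noteq> j" for i
    using that j by (auto simp: symbol_def)
  have "truncate \<kappa> c i \<odot>\<^bsub>graded_part j\<^esub> symbol (k i) (v i) j =
      (if j = \<kappa> then c i \<odot>\<^bsub>graded_part j\<^esub> symbol (k i) (v i) j else \<zero>\<^bsub>graded_part j\<^esub>)" if i: "i \<in> J" for i
  proof -
    have c: "c i \<in> carrier R" "truncate \<kappa> c i \<in> carrier R"
      using c truncate_closed[OF c] i by auto
    show ?thesis
    proof (cases "k i = j")
      case True
      then show ?thesis
        using symb[OF i] by (simp add: truncate_def)
    next
      case False
      show ?thesis
        unfolding other[OF False] using c[THEN Q.smult_r_null] by (simp only: if_cancel)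
    qed
  qed
  then have "gcomb (truncate \<kappa> c) j =
      (\<Oplus>\<^bsub>graded_part j\<^esub>i\<in>J. if j = \<kappa> then c i \<odot>\<^bsub>graded_part j\<^esub> symbol (k i) (v i) j else \<zero>\<^bsub>graded_part j\<^esub>)"
    unfolding gcomb_eval[OF truncate_closed[OF c] j] by (rule finsum_fundef_cong[OF refl])
  then show ?thesis
    unfolding gcomb_eval[OF c j] by (cases "j = \<kappa>") simp_all
qed

text \<open>Induction on a bound \<kappa> for the degrees in which c is nonzero. The class of a
  vanishing combination in the highest degree is zero, so independence of the symbols kills the
  coefficients of that degree and lowers the bound; c itself stays fixed.\<close>

lemma comb_eq_zero:
  assumes c: "c \<in> J \<rightarrow> carrier R" and zero: "comb c = \<zero>\<^bsub>V\<^esub>" and i: "i \<in> J"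
  shows "c i = \<zero>\<^bsub>R\<^esub>"
proof -
  interpret g: vectorspace R graded by (rule vectorspace_graded)
  have "\<kappa> \<le> int n \<Longrightarrow> c \<in> J \<rightarrow> carrier R \<Longrightarrow> (\<forall>i\<in>J. \<kappa> < k i \<longrightarrow> c i = \<zero>\<^bsub>R\<^esub>) \<Longrightarrow> comb c = \<zero>\<^bsub>V\<^esub> \<Longrightarrow>
      \<forall>i\<in>J. c i = \<zero>\<^bsub>R\<^esub>" if "-1 \<le> \<kappa>" for \<kappa> c
    using that
  proof (induction \<kappa> rule: int_ge_induct)
    \<comment> \<open>All degrees \<open>k i\<close> are at least 0, so the bound -1 already says
      that every coefficient vanishes.\<close>
    case base
    then show ?case using k by force
  next
    case (step \<kappa>)
    have c: "c \<in> J \<rightarrow> carrier R" and \<kappa>: "\<kappa> + 1 \<in> {0..int n}"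
      using step by auto
    have "gcomb c (\<kappa> + 1) = cls (\<kappa> + 1) \<zero>\<^bsub>V\<^esub>"
      using comb_cls(2)[OF c \<kappa>] step.prems by auto
    also have "\<dots> = \<zero>\<^bsub>graded_part (\<kappa> + 1)\<^esub>"
      using cls_zero_iff[of "\<zero>\<^bsub>V\<^esub>" "\<kappa> + 1"] submodule.zero_closed[OF submodule_W] by simp
    \<comment> \<open>Truncation clears the coordinates other than \<kappa> + 1, and coordinate
      \<kappa> + 1 has just been shown to be zero.\<close>
    finally have "gcomb (truncate (\<kappa> + 1) c) = \<zero>\<^bsub>graded\<^esub>"
      using gcomb_truncate[OF c]
      by (intro graded_eqI gcomb_closed truncate_closed c g.M.zero_closed) (auto simp: dsum_module_def)
    then have trunc: "truncate (\<kappa> + 1) c i = \<zero>\<^bsub>R\<^esub>" if "i \<in> J" for i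
      using independent[OF truncate_closed[OF c] _ that] by (simp add: gcomb_def)
    have "c i = \<zero>\<^bsub>R\<^esub>" if "i \<in> J" "\<kappa> < k i" for i
      using that trunc[of i] step.prems(3) by (cases "k i = \<kappa> + 1") (auto simp: truncate_def)
    then show ?case
      using step.IH[OF _ c] step.prems by simp
  qed
  from this[of "int n" c] show ?thesis
    using c zero i k by force
qed

text \<open>Successive approximation: subtracting a combination with the same class in degree
  \<kappa> + 1 pushes x down to W \<kappa>, until W (-1) = 0 is reached. The induction must
  therefore allow x to vary.\<close>

lemma comb_surj:
  assumes x: "x \<in> carrier V"
  shows "\<exists>c\<in>J \<rightarrow> carrier R. x = comb c"
proof -
  have "\<kappa> \<le> int n \<Longrightarrow> x \<in> W \<kappa> \<Longrightarrow> \<exists>c\<in>J \<rightarrow> carrier R. x = comb c" if "-1 \<le> \<kappa>" for \<kappa> x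
    using that
  proof (induction \<kappa> arbitrary: x rule: int_ge_induct)
    case base
    have "comb (\<lambda>_. \<zero>\<^bsub>R\<^esub>) = (\<Oplus>\<^bsub>V\<^esub>i\<in>J. \<zero>\<^bsub>V\<^esub>)"
      unfolding comb_def using W_carrier[OF v] by (intro finsum_fundef_cong) auto
    then have "x = comb (\<lambda>_. \<zero>\<^bsub>R\<^esub>)"
      using base W_bot by simp
    then show ?case
      by (intro bexI[of _ "\<lambda>_. \<zero>\<^bsub>R\<^esub>"]) auto
  next
    case (step \<kappa>)
    have \<kappa>: "\<kappa> + 1 \<in> {0..int n}" and xV: "x \<in> carrier V"
      using step W_carrier by auto
    obtain c where c: "c \<in> J \<rightarrow> carrier R" "symbol (\<kappa> + 1) x = gcomb c"
      using spanning[OF symbol_closed[OF step.prems(2)]] by (auto simp: gcomb_def)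
    \<comment> \<open>Keeping only generators of degree \<kappa> + 1 puts \<open>comb c'\<close>
      into W (\<kappa> + 1) by construction, and its class there is still that of x.\<close>
    define c' where "c' = truncate (\<kappa> + 1) c"
    have c': "c' \<in> J \<rightarrow> carrier R"
      by (simp add: c'_def truncate_closed c)
    have comb: "comb c' \<in> W (\<kappa> + 1)" "cls (\<kappa> + 1) (comb c') = gcomb c' (\<kappa> + 1)"
      by (rule comb_cls[OF c' \<kappa>]; simp add: c'_def truncate_def)+
    then have "cls (\<kappa> + 1) x = cls (\<kappa> + 1) (comb c')"
      using gcomb_truncate[OF c(1) \<kappa>, of "\<kappa> + 1"] c(2) \<kappa> by (simp add: c'_def symbol_def flip: c(2))
    then have "x \<ominus>\<^bsub>V\<^esub> comb c' \<in> W \<kappa>"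
      using submodule.coset_eq_iff[OF submodule_W, of x "comb c'"] xV comb W_carrier by simp
    then obtain c'' where c'': "c'' \<in> J \<rightarrow> carrier R" "x \<ominus>\<^bsub>V\<^esub> comb c' = comb c''"
      using step by auto
    have "comb (\<lambda>i. c'' i \<oplus>\<^bsub>R\<^esub> c' i) = (\<Oplus>\<^bsub>V\<^esub>i\<in>J. c'' i \<odot>\<^bsub>V\<^esub> v i \<oplus>\<^bsub>V\<^esub> c' i \<odot>\<^bsub>V\<^esub> v i)"
      unfolding comb_def using c' c'' W_carrier[OF v]
      by (intro finsum_fundef_cong) (auto simp: Pi_iff V.smult_l_distr)
    also have "\<dots> = comb c'' \<oplus>\<^bsub>V\<^esub> comb c'"
      unfolding comb_def using c' c'' W_carrier[OF v]
      by (intro V.M.finsum_addf) (auto simp: Pi_iff)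
    also have "\<dots> = x"
      using xV W_carrier[OF comb(1)] unfolding c''(2)[symmetric] by (simp add: a_minus_def V.M.a_assoc V.M.l_neg)
    finally show ?case
      using c' c'' by (intro bexI[of _ "\<lambda>i. c'' i \<oplus>\<^bsub>R\<^esub> c' i"]) auto
  qed
  from this[of "int n" x] show ?thesis
    using x W_top by auto
qed

end

section \<open>Filtered persistence modules\<close>

locale filtered_pmod =
  fixes R :: "'f ring" and V :: "('f, 'v) pmod" and W :: "int \<Rightarrow> real \<Rightarrow> 'v set" and n :: nat
  assumes persistence_V: "persistence_module R V"
    and filtered: "filtered_space R (pspace V r) (\<lambda>\<kappa>. W \<kappa> r) n"
    and stable: "r \<le> s \<Longrightarrow> x \<in> W \<kappa> r \<Longrightarrow> pmap V r s x \<in> W \<kappa> s"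
begin

definition filt :: "int \<Rightarrow> ('f, 'v) pmod" where
  "filt \<kappa> = \<lparr>pspace = (\<lambda>r. (pspace V r)\<lparr>carrier := W \<kappa> r\<rparr>), pmap = pmap V\<rparr>"

definition part :: "int \<Rightarrow> ('f, 'v set) pmod" where
  "part \<kappa> = pm_quot (filt \<kappa>) (filt (\<kappa> - 1))"

definition graded_pm :: "('f, int \<Rightarrow> 'v set) pmod" where
  "graded_pm = pm_dsum {0..int n} part"

sublocale fs: filtered_space R "pspace V r" "\<lambda>\<kappa>. W \<kappa> r" n for r
  by (rule filtered)

abbreviation "symb r \<equiv> filtered_space.symbol (pspace V r) (\<lambda>\<kappa>. W \<kappa> r) n"
abbreviation "gpart r \<equiv> filtered_space.graded_part (pspace V r) (\<lambda>\<kappa>. W \<kappa> r)"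

lemma pspace_part: "pspace (part \<kappa>) r = gpart r \<kappa>"
  by (simp add: part_def pm_quot_def filt_def fs.graded_part_def)

lemma pspace_graded: "pspace graded_pm r = dsum_module {0..int n} (gpart r)"
  by (simp add: graded_pm_def pm_dsum_def pspace_part)

lemma proj_eq: "pm_proj (filt \<kappa>) (filt (\<kappa> - 1)) r x = W (\<kappa> - 1) r +>\<^bsub>pspace V r\<^esub> x"
  by (simp add: pm_proj_def filt_def)

text \<open>Identifies the symbol with the quotient morphism followed by the inclusion of the
  summand, the form in which the condition on lifts is given for the Mayer--Vietoris module.\<close>

lemma symbol_eq: "symb r \<kappa> x = dsum_incl {0..int n} part \<kappa> r (pm_proj (filt \<kappa>) (filt (\<kappa> - 1)) r x)"
  unfolding fs.symbol_def dsum_incl_def proj_eq pspace_part ..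

text \<open>Independence of the representative: two representatives differ by an element of W
  (\<kappa> - 1) r, which \<open>stable\<close> carries into W (\<kappa> - 1) s.\<close>

lemma part_map:
  assumes rs: "r \<le> s" and x: "x \<in> carrier (pspace V r)"
  shows "pmap (part \<kappa>) r s (W (\<kappa> - 1) r +>\<^bsub>pspace V r\<^esub> x) = W (\<kappa> - 1) s +>\<^bsub>pspace V s\<^esub> pmap V r s x"
proof -
  interpret W: submodule R "W (\<kappa> - 1) r" "pspace V r" by (rule fs.submodule_W)
  interpret W': submodule R "W (\<kappa> - 1) s" "pspace V s" by (rule fs.submodule_W)
  interpret mod_hom R "pspace V r" "pspace V s" "pmap V r s"
    using persistence_module.map_hom[OF persistence_V rs] by unfold_locales
  have "W (\<kappa> - 1) s +>\<^bsub>pspace V s\<^esub> pmap V r s y = W (\<kappa> - 1) s +>\<^bsub>pspace V s\<^esub> pmap V r s x"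
    if "y \<in> W (\<kappa> - 1) r +>\<^bsub>pspace V r\<^esub> x" for y
  proof -
    have y: "y \<in> carrier (pspace V r)"
      using W.coset_cong[OF that x] by simp
    then have "y \<ominus>\<^bsub>pspace V r\<^esub> x \<in> W (\<kappa> - 1) r"
      using W.coset_cong[OF that x] W.coset_eq_iff[OF y x] by simp
    then have "pmap V r s y \<ominus>\<^bsub>pspace V s\<^esub> pmap V r s x \<in> W (\<kappa> - 1) s"
      using stable[OF rs] f_minus[OF y x] by metis
    then show ?thesis
      using W'.coset_eq_iff x y by simp
  qed
  from W.coset_UN[OF x, of "\<lambda>y. W (\<kappa> - 1) s +>\<^bsub>pspace V s\<^esub> pmap V r s y", OF this] show ?thesis
    by (simp add: part_def pm_quot_def proj_eq) (simp add: filt_def)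
qed

lemma graded_map_symbol:
  assumes rs: "r \<le> s" and x: "x \<in> W \<kappa> r"
  shows "pmap graded_pm r s (symb r \<kappa> x) = symb s \<kappa> (pmap V r s x)"
proof -
  interpret mod_hom R "pspace V r" "pspace V s" "pmap V r s"
    using persistence_module.map_hom[OF persistence_V rs] by unfold_locales
  \<comment> \<open>Writing the zero of each summand as the class of 0 lets \<open>part_map\<close>
    handle all coordinates alike.\<close>
  have zero: "\<zero>\<^bsub>gpart t j\<^esub> = W (j - 1) t +>\<^bsub>pspace V t\<^esub> \<zero>\<^bsub>pspace V t\<^esub>" for t j
    by (rule sym) (simp add: fs.cls_zero_iff submodule.zero_closed[OF fs.submodule_W])
  have "pmap (part j) r s (if j = \<kappa> then W (\<kappa> - 1) r +>\<^bsub>pspace V r\<^esub> x else \<zero>\<^bsub>gpart r j\<^esub>) =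
      (if j = \<kappa> then W (\<kappa> - 1) s +>\<^bsub>pspace V s\<^esub> pmap V r s x else \<zero>\<^bsub>gpart s j\<^esub>)" for j
    using part_map[OF rs fs.W_carrier[OF x]] part_map[OF rs fs.V.M.zero_closed] by (simp add: zero)
  then show ?thesis
    by (simp add: graded_pm_def pm_dsum_def fs.symbol_def cong: restrict_cong)
qed

text \<open>The condition on lifts speaks of the left end a i. Naturality of \<open>g i\<close> and
  of symbols spreads it over the bar, so at every r the symbols of the transported lifts are the
  active generators, a basis of the graded space.\<close>

theorem tilde_isomorphic:
  assumes basis: "barcode_basis R graded_pm {1..m} a b g"
    and k: "\<And>i. i \<in> {1..m} \<Longrightarrow> k i \<in> {0..int n}"
    and l: "\<And>i. i \<in> {1..m} \<Longrightarrow> l i \<in> W (k i) (a i)"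
    and lift: "\<And>i. i \<in> {1..m} \<Longrightarrow> symb (a i) (k i) (l i) = barcode_gen R graded_pm a b g i (a i)"
  shows "pm_isomorphic R (tilde_pm R graded_pm V m a b g l) V"
proof -
  interpret barcode R graded_pm m a b g
    by (rule barcode.intro) (simp_all add: pspace_graded fs.vectorspace_graded basis del: One_nat_def)
  have gen: "gen i r = symb r (k i) (pmap V (a i) r (l i))" if i: "i \<in> active r" for i r
  proof -
    have im: "i \<in> {1..m}" and r: "a i \<le> r" "r \<in> {a i..<b i}" and ai: "a i \<in> {a i..<b i}"
      using i by (auto simp: active_def)
    have "g i \<in> pm_hom R (interval_pm R (a i) (b i)) graded_pm"
      using basis im by (auto simp: barcode_basis_def)
    moreover have "\<one>\<^bsub>R\<^esub> \<in> carrier (pspace (interval_pm R (a i) (b i)) (a i))"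
      using ai fs.V.R.one_closed by (simp add: interval_carrier)
    ultimately have "g i r (pmap (interval_pm R (a i) (b i)) (a i) r \<one>\<^bsub>R\<^esub>) = pmap graded_pm (a i) r (g i (a i) \<one>\<^bsub>R\<^esub>)"
      using r(1) by (simp add: pm_hom_def)
    moreover have "pmap (interval_pm R (a i) (b i)) (a i) r \<one>\<^bsub>R\<^esub> = \<one>\<^bsub>R\<^esub>"
      using r(2) ai by (simp add: interval_pm_def)
    ultimately have "gen i r = pmap graded_pm (a i) r (gen i (a i))"
      using r(2) ai by (simp add: barcode_gen_def)
    also have "\<dots> = symb r (k i) (pmap V (a i) r (l i))"
      unfolding lift[OF im, symmetric] by (rule graded_map_symbol[OF r(1) l[OF im]])
    finally show ?thesis .
  qed
  have act: "i \<in> active r \<Longrightarrow> i \<in> {1..m} \<and> a i \<le> r" for i r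
    by (auto simp: active_def)
  have G: "(\<Oplus>\<^bsub>fs.graded r\<^esub>i\<in>active r. c i \<odot>\<^bsub>fs.graded r\<^esub> symb r (k i) (pmap V (a i) r (l i))) =
      (\<Oplus>\<^bsub>pspace graded_pm r\<^esub>i\<in>active r. c i \<odot>\<^bsub>pspace graded_pm r\<^esub> gen i r)" for c r
    unfolding pspace_graded by (intro finsum_fundef_cong refl) (simp add: gen)
  have lift_space: "filtered_space_lift R (pspace V r) (\<lambda>\<kappa>. W \<kappa> r) n (active r) k (\<lambda>i. pmap V (a i) r (l i))" for r
  proof (intro filtered_space_lift.intro filtered_space_lift_axioms.intro filtered)
    show "k i \<in> {0..int n}" if "i \<in> active r" for i
      using act[OF that] k by blast
    show "pmap V (a i) r (l i) \<in> W (k i) r" if "i \<in> active r" for i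
      using act[OF that] l stable by blast
    show "c i = \<zero>\<^bsub>R\<^esub>" if c: "c \<in> active r \<rightarrow> carrier R"
      and z: "(\<Oplus>\<^bsub>fs.graded r\<^esub>i\<in>active r. c i \<odot>\<^bsub>fs.graded r\<^esub> symb r (k i) (pmap V (a i) r (l i))) = \<zero>\<^bsub>fs.graded r\<^esub>"
      and i: "i \<in> active r" for c i
    proof -
      interpret g: vectorspace R "pspace graded_pm r" by (rule vectorspace_G)
      \<comment> \<open>Zero is written as the combination with zero coefficients, so that
        uniqueness of coordinates yields independence.\<close>
      have "(\<Oplus>\<^bsub>pspace graded_pm r\<^esub>i\<in>active r. \<zero>\<^bsub>R\<^esub> \<odot>\<^bsub>pspace graded_pm r\<^esub> gen i r) = (\<Oplus>\<^bsub>pspace graded_pm r\<^esub>i\<in>active r. \<zero>\<^bsub>pspace graded_pm r\<^esub>)"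
        using act gen_closed by (intro finsum_fundef_cong refl g.smult_l_null) blast
      then have "(\<Oplus>\<^bsub>pspace graded_pm r\<^esub>i\<in>active r. c i \<odot>\<^bsub>pspace graded_pm r\<^esub> gen i r) =
          (\<Oplus>\<^bsub>pspace graded_pm r\<^esub>i\<in>active r. \<zero>\<^bsub>R\<^esub> \<odot>\<^bsub>pspace graded_pm r\<^esub> gen i r)"
        using z unfolding G unfolding pspace_graded[symmetric] by simp
      moreover have "(\<lambda>_. \<zero>\<^bsub>R\<^esub>) \<in> active r \<rightarrow> carrier R"
        by simp
      ultimately show ?thesis
        using coord_finsum[OF c i] coord_finsum[OF _ i, of "\<lambda>_. \<zero>\<^bsub>R\<^esub>"] by metis
    qed
    show "\<exists>c\<in>active r \<rightarrow> carrier R. y =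
        (\<Oplus>\<^bsub>fs.graded r\<^esub>i\<in>active r. c i \<odot>\<^bsub>fs.graded r\<^esub> symb r (k i) (pmap V (a i) r (l i)))"
      if y: "y \<in> carrier (fs.graded r)" for y
    proof (rule bexI)
      show "y = (\<Oplus>\<^bsub>fs.graded r\<^esub>i\<in>active r. coord r y i \<odot>\<^bsub>fs.graded r\<^esub> symb r (k i) (pmap V (a i) r (l i)))"
        unfolding G using y by (intro gen_expansion[symmetric]) (simp add: pspace_graded)
      show "coord r y \<in> active r \<rightarrow> carrier R"
        using y by (intro Pi_I coord_closed) (simp_all add: pspace_graded)
    qed
  qed simp
  interpret barcode_lift R graded_pm m a b g V l
  proof (intro barcode_lift.intro barcode_lift_axioms.intro barcode_axioms)
    show "persistence_module R V" by (rule persistence_V)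
    show "l i \<in> carrier (pspace V (a i))" if "i \<in> {1..m}" for i
      using l[OF that] fs.W_carrier by blast
    show "c i = \<zero>\<^bsub>R\<^esub>" if "c \<in> active r \<rightarrow> carrier R"
      "(\<Oplus>\<^bsub>pspace V r\<^esub>i\<in>active r. c i \<odot>\<^bsub>pspace V r\<^esub> pmap V (a i) r (l i)) = \<zero>\<^bsub>pspace V r\<^esub>"
      "i \<in> active r" for c r i
      using filtered_space_lift.comb_eq_zero[OF lift_space that(1) _ that(3)] that(2)
      unfolding filtered_space_lift.comb_def[OF lift_space] by blast
    show "\<exists>c\<in>active r \<rightarrow> carrier R. x = (\<Oplus>\<^bsub>pspace V r\<^esub>i\<in>active r. c i \<odot>\<^bsub>pspace V r\<^esub> pmap V (a i) r (l i))"
      if "x \<in> carrier (pspace V r)" for x r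
      using filtered_space_lift.comb_surj[OF lift_space that]
      unfolding filtered_space_lift.comb_def[OF lift_space] .
  qed
  show ?thesis by (rule tilde_isomorphic)
qed

end

section \<open>Homology of filtered complexes\<close>

text \<open>At n = 0 the truncated subtraction makes \<open>D 0\<close> an endomorphism of
  \<open>C 0\<close>. For the total complex it is the zero map, so every chain of degree 0 is a
  cycle.\<close>

locale pm_chain_complex =
  fixes R :: "'f ring" and C :: "nat \<Rightarrow> ('f, 'a) pmod" and D :: "nat \<Rightarrow> real \<Rightarrow> 'a \<Rightarrow> 'a"
  assumes persistence_C: "persistence_module R (C n)"
    and diff_hom: "D n r \<in> LinearCombinations.module_hom R (pspace (C n) r) (pspace (C (n - 1)) r)"
    and diff_natural: "r \<le> s \<Longrightarrow> x \<in> carrier (pspace (C n) r) \<Longrightarrow>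
      D n s (pmap (C n) r s x) = pmap (C (n - 1)) r s (D n r x)"
begin

declare One_nat_def [simp del]

abbreviation "cycles \<equiv> pm_cycles C D"
abbreviation "boundaries \<equiv> pm_boundaries C D"
abbreviation "H \<equiv> pm_homology C D"
abbreviation "hclass n r x \<equiv> boundaries n r +>\<^bsub>pspace (C n) r\<^esub> x"

lemma vectorspace_C: "vectorspace R (pspace (C n) r)"
  by (rule persistence_module.vectorspace[OF persistence_C])

lemma diff_mod_hom: "mod_hom R (pspace (C n) r) (pspace (C (n - 1)) r) (D n r)"
proof -
  interpret A: vectorspace R "pspace (C n) r" by (rule vectorspace_C)
  interpret B: vectorspace R "pspace (C (n - 1)) r" by (rule vectorspace_C)
  show ?thesis
    using diff_hom by unfold_locales
qed

lemma pmap_mod_hom: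
  assumes "r \<le> s"
  shows "mod_hom R (pspace (C n) r) (pspace (C n) s) (pmap (C n) r s)"
proof -
  interpret A: vectorspace R "pspace (C n) r" by (rule vectorspace_C)
  interpret B: vectorspace R "pspace (C n) s" by (rule vectorspace_C)
  show ?thesis
    using persistence_module.map_hom[OF persistence_C assms] by unfold_locales
qed

lemma submodule_cycles: "LinearCombinations.submodule R (cycles n r) (pspace (C n) r)"
proof -
  have "cycles n r = mod_hom.ker (pspace (C n) r) (pspace (C (n - 1)) r) (D n r)"
    unfolding pm_cycles_def mod_hom.ker_def[OF diff_mod_hom] ..
  then show ?thesis
    by (simp add: mod_hom.ker_is_submodule[OF diff_mod_hom])
qed

lemma submodule_boundaries: "LinearCombinations.submodule R (boundaries n r) (pspace (C n) r)"
proof -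
  have "boundaries n r = mod_hom.im (pspace (C (Suc n)) r) (D (Suc n) r)"
    using mod_hom.im_def[OF diff_mod_hom[of "Suc n" r]] by (simp add: pm_boundaries_def)
  then show ?thesis
    using mod_hom.im_is_submodule[OF diff_mod_hom, of "Suc n" r] by simp
qed

lemma cycles_carrier: "x \<in> cycles n r \<Longrightarrow> x \<in> carrier (pspace (C n) r)"
  by (simp add: pm_cycles_def)

lemma cycles_stable:
  assumes rs: "r \<le> s" and x: "x \<in> cycles n r"
  shows "pmap (C n) r s x \<in> cycles n s"
  using assms mod_hom.f_im[OF pmap_mod_hom[OF rs]] mod_hom.f0_is_0[OF pmap_mod_hom[OF rs]]
  by (simp add: pm_cycles_def diff_natural)

lemma boundaries_stable:
  assumes rs: "r \<le> s" and x: "x \<in> boundaries n r"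
  shows "pmap (C n) r s x \<in> boundaries n s"
proof -
  obtain y where y: "y \<in> carrier (pspace (C (Suc n)) r)" "x = D (Suc n) r y"
    using x by (auto simp: pm_boundaries_def)
  then have "pmap (C n) r s x = D (Suc n) s (pmap (C (Suc n)) r s y)"
    using diff_natural[OF rs y(1)] by simp
  then show ?thesis
    using mod_hom.f_im[OF pmap_mod_hom[OF rs] y(1)] by (simp add: pm_boundaries_def)
qed

(* The quotient is formed inside C n, that is, as (Z + B) / B, so that it makes sense without B
   being contained in Z. *)
lemma pspace_homology:
  "pspace (H n) r = quot_module ((pspace (C n) r)\<lparr>carrier := cycles n r\<rparr>) (boundaries n r)"
  by (simp add: pm_homology_def)

lemma homology_carrier: "carrier (pspace (H n) r) = hclass n r ` cycles n r"
  by (simp add: pspace_homology quot_module_carrier)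

lemma vectorspace_homology: "vectorspace R (pspace (H n) r)"
  unfolding pspace_homology
  by (intro quot_module_vectorspace submodule_boundaries vectorspace_submodule vectorspace_C submodule_cycles)
    (auto dest: cycles_carrier)

lemma hclass_add:
  assumes "x \<in> carrier (pspace (C n) r)" "y \<in> carrier (pspace (C n) r)"
  shows "hclass n r (x \<oplus>\<^bsub>pspace (C n) r\<^esub> y) = hclass n r x \<oplus>\<^bsub>pspace (H n) r\<^esub> hclass n r y"
proof -
  interpret vectorspace R "pspace (C n) r" by (rule vectorspace_C)
  show ?thesis
    unfolding pspace_homology using quot_module_coset(1)[OF submodule_boundaries assms R.one_closed] by simp
qed

lemma hclass_smult:
  assumes "x \<in> carrier (pspace (C n) r)" "c \<in> carrier R"
  shows "hclass n r (c \<odot>\<^bsub>pspace (C n) r\<^esub> x) = c \<odot>\<^bsub>pspace (H n) r\<^esub> hclass n r x"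
  unfolding pspace_homology using quot_module_coset(2)[OF submodule_boundaries assms(1,1,2)] by simp

lemma hclass_zero: "hclass n r \<zero>\<^bsub>pspace (C n) r\<^esub> = \<zero>\<^bsub>pspace (H n) r\<^esub>"
  unfolding pspace_homology using quot_module_zero[OF submodule_boundaries] by simp

text \<open>By naturality of the differential, structure maps send boundaries to boundaries;
  homologous representatives thus have homologous images.\<close>

lemma homology_map:
  assumes rs: "r \<le> s" and x: "x \<in> carrier (pspace (C n) r)"
  shows "pmap (H n) r s (hclass n r x) = hclass n s (pmap (C n) r s x)"
proof -
  interpret B: submodule R "boundaries n r" "pspace (C n) r" by (rule submodule_boundaries)
  interpret B': submodule R "boundaries n s" "pspace (C n) s" by (rule submodule_boundaries)
  interpret mod_hom R "pspace (C n) r" "pspace (C n) s" "pmap (C n) r s" by (rule pmap_mod_hom[OF rs])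
  have "hclass n s (pmap (C n) r s y) = hclass n s (pmap (C n) r s x)" if "y \<in> hclass n r x" for y
  proof -
    have y: "y \<in> carrier (pspace (C n) r)" "y \<ominus>\<^bsub>pspace (C n) r\<^esub> x \<in> boundaries n r"
      using B.coset_cong[OF that x] B.coset_eq_iff[of y x] x by simp_all
    then have "pmap (C n) r s y \<ominus>\<^bsub>pspace (C n) s\<^esub> pmap (C n) r s x \<in> boundaries n s"
      using boundaries_stable[OF rs y(2)] f_minus[OF y(1) x] by simp
    then show ?thesis
      using B'.coset_eq_iff x y by simp
  qed
  from B.coset_UN[OF x, of "\<lambda>y. hclass n s (pmap (C n) r s y)", OF this] show ?thesis
    by (simp add: pm_homology_def)
qed

lemma persistence_homology: "persistence_module R (H n)"
proof (rule persistence_module.intro)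
  show "vectorspace R (pspace (H n) r)" for r by (rule vectorspace_homology)
  show "pmap (H n) r s \<in> LinearCombinations.module_hom R (pspace (H n) r) (pspace (H n) s)"
    if rs: "r \<le> s" for r s
  proof -
    interpret mod_hom R "pspace (C n) r" "pspace (C n) s" "pmap (C n) r s" by (rule pmap_mod_hom[OF rs])
    show ?thesis
      unfolding LinearCombinations.module_hom_def homology_carrier
      by (auto simp: homology_map[OF rs] cycles_carrier cycles_stable[OF rs] simp flip: hclass_add hclass_smult)
  qed
  show "pmap (H n) r r x = x" if "x \<in> carrier (pspace (H n) r)" for x r
    using that persistence_module.map_id[OF persistence_C]
    by (auto simp: homology_carrier homology_map cycles_carrier)
  show "pmap (H n) s t (pmap (H n) r s x) = pmap (H n) r t x"
    if "r \<le> s" "s \<le> t" "x \<in> carrier (pspace (H n) r)" for x r s t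
    using that persistence_module.map_comp[OF persistence_C] cycles_stable
    by (auto simp: homology_carrier homology_map cycles_carrier)
qed

end

text \<open>\<open>E\<close> is tied to \<open>C\<close> by an equation, so the filtration steps
  share its operations and structure maps and differ in their carriers S. The bounds -1 and n
  reflect that bidegrees (p, q) with p + q = n have 0 \<le> p \<le> n.\<close>

locale filtered_chain_complex = pm_chain_complex R C D
  for R :: "'f ring" and C :: "nat \<Rightarrow> ('f, 'a) pmod" and D +
  fixes E :: "int \<Rightarrow> nat \<Rightarrow> ('f, 'a) pmod" and S :: "int \<Rightarrow> nat \<Rightarrow> real \<Rightarrow> 'a set"
  assumes E: "E \<kappa> n = \<lparr>pspace = (\<lambda>r. (pspace (C n) r)\<lparr>carrier := S \<kappa> n r\<rparr>), pmap = pmap (C n)\<rparr>"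
    and submodule_S: "LinearCombinations.submodule R (S \<kappa> n r) (pspace (C n) r)"
    and S_mono: "\<kappa> \<le> \<kappa>' \<Longrightarrow> S \<kappa> n r \<subseteq> S \<kappa>' n r"
    and S_bot: "S (-1) n r = {\<zero>\<^bsub>pspace (C n) r\<^esub>}"
    and S_top: "S (int n) n r = carrier (pspace (C n) r)"
    and S_stable: "r \<le> s \<Longrightarrow> x \<in> S \<kappa> n r \<Longrightarrow> pmap (C n) r s x \<in> S \<kappa> n s"
begin

definition W :: "nat \<Rightarrow> int \<Rightarrow> real \<Rightarrow> 'a set set" where
  "W n \<kappa> r = hclass n r ` (S \<kappa> n r \<inter> cycles n r)"

lemma S_carrier: "x \<in> S \<kappa> n r \<Longrightarrow> x \<in> carrier (pspace (C n) r)"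
  using submodule.subset[OF submodule_S] by blast

text \<open>A class of the filtration step is a coset of the boundaries of that step. Since these
  are boundaries of the full complex, the inclusion enlarges it to the full class of the same
  cycle.\<close>

lemma image_homology_incl:
  "pm_homology_incl C D n r ` carrier (pspace (pm_homology (E \<kappa>) D n) r) = W n \<kappa> r"
proof -
  have cyc: "pm_cycles (E \<kappa>) D n r = S \<kappa> n r \<inter> cycles n r"
    using S_carrier by (auto simp: pm_cycles_def E)
  have bd: "pm_boundaries (E \<kappa>) D n r = D (Suc n) r ` S \<kappa> (Suc n) r"
    by (simp add: pm_boundaries_def E)
  have "submodule R (D (Suc n) r ` S \<kappa> (Suc n) r) (pspace (C n) r)"
  proof -
    interpret C: vectorspace R "pspace (C n) r" by (rule vectorspace_C)
    interpret mod_hom R "pspace (C (Suc n)) r" "pspace (C n) r" "D (Suc n) r"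
      using diff_mod_hom[of "Suc n" r] by simp
    show ?thesis
      by (rule submodule_hom_image[OF submodule_S C.module_axioms]) (simp_all add: S_carrier)
  qed
  then interpret B': submodule R "D (Suc n) r ` S \<kappa> (Suc n) r" "pspace (C n) r" .
  interpret B: submodule R "boundaries n r" "pspace (C n) r" by (rule submodule_boundaries)
  have incl: "pm_homology_incl C D n r (D (Suc n) r ` S \<kappa> (Suc n) r +>\<^bsub>pspace (C n) r\<^esub> x) = hclass n r x"
    if x: "x \<in> carrier (pspace (C n) r)" for x
  proof -
    have "hclass n r y = hclass n r x" if "y \<in> D (Suc n) r ` S \<kappa> (Suc n) r +>\<^bsub>pspace (C n) r\<^esub> x" for y
    proof -
      have y: "y \<in> carrier (pspace (C n) r)" "y \<ominus>\<^bsub>pspace (C n) r\<^esub> x \<in> D (Suc n) r ` S \<kappa> (Suc n) r"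
        using B'.coset_cong[OF that x] B'.coset_eq_iff[of y x] x by simp_all
      then have "y \<ominus>\<^bsub>pspace (C n) r\<^esub> x \<in> boundaries n r"
        using S_carrier by (auto simp: pm_boundaries_def)
      then show ?thesis
        using B.coset_eq_iff x y by simp
    qed
    from B'.coset_UN[OF x, of "hclass n r", OF this] show ?thesis
      by (simp add: pm_homology_incl_def)
  qed
  show ?thesis
    unfolding W_def pm_homology_def pmod.simps quot_module_carrier cyc bd
    by (simp add: image_image E) (intro image_cong refl incl, simp add: cycles_carrier)
qed

lemma filtered_homology: "filtered_pmod R (H n) (W n) n"
proof (rule filtered_pmod.intro[OF persistence_homology filtered_space.intro[OF vectorspace_homology]])
  show "submodule R (W n \<kappa> r) (pspace (H n) r)" for \<kappa> r
  proof -
    interpret H: vectorspace R "pspace (H n) r" by (rule vectorspace_homology)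
    interpret S: submodule R "S \<kappa> n r" "pspace (C n) r" by (rule submodule_S)
    interpret Z: submodule R "cycles n r" "pspace (C n) r" by (rule submodule_cycles)
    have "submodule R (S \<kappa> n r \<inter> cycles n r) (pspace (C n) r)"
      by (rule submodule.intro[OF S.module]) (use S.subset in auto)
    then show ?thesis
      unfolding W_def
      by (rule submodule_hom_image[OF _ H.module_axioms])
        (auto simp: homology_carrier hclass_add hclass_smult cycles_carrier)
  qed
  show "W n \<kappa> r \<subseteq> W n \<kappa>' r" if "\<kappa> \<le> \<kappa>'" for \<kappa> \<kappa>' r
    using S_mono[OF that] by (auto simp: W_def)
  show "W n (-1) r = {\<zero>\<^bsub>pspace (H n) r\<^esub>}" for r
    using submodule.zero_closed[OF submodule_cycles, of n r] hclass_zero[of n r] by (simp add: W_def S_bot)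
  show "W n (int n) r = carrier (pspace (H n) r)" for r
    using cycles_carrier[of _ n r] by (auto simp: W_def S_top homology_carrier)
  show "pmap (H n) r s x \<in> W n \<kappa> s" if "r \<le> s" "x \<in> W n \<kappa> r" for x \<kappa> r s
    using that S_stable cycles_stable by (auto simp: W_def homology_map cycles_carrier)
qed

lemma homology_filt_eq:
  "pm_image (pm_homology_incl C D n) (pm_homology (E \<kappa>) D n) (H n) = filtered_pmod.filt (H n) (W n) \<kappa>"
  by (simp add: pm_image_def image_homology_incl filtered_pmod.filt_def[OF filtered_homology])

end

section \<open>Chains\<close>

abbreviation scal :: "'f::field \<Rightarrow> ('a \<Rightarrow>\<^sub>0 'f) \<Rightarrow> ('a \<Rightarrow>\<^sub>0 'f)" where
  "scal t \<equiv> Poly_Mapping.map ((*) t)"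

lemma lookup_scal: "Poly_Mapping.lookup (scal t c) x = t * Poly_Mapping.lookup c x"
  by (simp add: Poly_Mapping.map.rep_eq when_def)

lemma keys_scal: "Poly_Mapping.keys (scal t c) \<subseteq> Poly_Mapping.keys c"
  by (auto simp: in_keys_iff lookup_scal)

lemma scal_simps:
  "scal t 0 = 0" "scal t (c + d) = scal t c + scal t d" "scal (t + u) c = scal t c + scal u c"
  "scal (t * u) c = scal t (scal u c)" "scal 1 c = c"
  "scal t (Poly_Mapping.single x y) = Poly_Mapping.single x (t * y)"
  by (auto intro!: poly_mapping_eqI simp: lookup_scal lookup_add lookup_single when_def algebra_simps)

lemma scal_commute: "scal t (scal u c) = scal u (scal t c)"
  by (auto intro!: poly_mapping_eqI simp: lookup_scal)

lemma scal_sum: "scal t (sum h A) = (\<Sum>x\<in>A. scal t (h x))"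
  by (induction A rule: infinite_finite_induct) (simp_all add: scal_simps)

lemma chain_module_vectorspace:
  "vectorspace (ring_of_type_algebra :: 'f::field ring) (chain_module q L :: ('f, 'v set \<Rightarrow>\<^sub>0 'f) module)"
proof (rule vs_criteria[OF field_from_type_algebra])
  show "\<forall>v\<in>carrier (chain_module q L). \<exists>w\<in>carrier (chain_module q L).
      v \<oplus>\<^bsub>chain_module q L\<^esub> w = (\<zero>\<^bsub>chain_module q L\<^esub> :: 'v set \<Rightarrow>\<^sub>0 'f)"
    by (auto simp: chain_module_def intro!: exI[of _ "- _"])
qed (use Poly_Mapping.keys_add keys_scal in \<open>fastforce simp: chain_module_def ring_of_type_algebra_def scal_simps ac_simps\<close>)+

lemma persistence_module_chain:
  assumes "\<And>r s. r \<le> s \<Longrightarrow> L r \<subseteq> L s"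
  shows "persistence_module (ring_of_type_algebra :: 'f::field ring) (chain_pm q L :: ('f, 'v set \<Rightarrow>\<^sub>0 'f) pmod)"
proof (rule persistence_module.intro)
  show "pmap (chain_pm q L) r s \<in> LinearCombinations.module_hom ring_of_type_algebra
      (pspace (chain_pm q L) r) (pspace (chain_pm q L :: ('f, 'v set \<Rightarrow>\<^sub>0 'f) pmod) s)" if "r \<le> s" for r s
    using assms[OF that] by (auto simp: chain_pm_def chain_module_def LinearCombinations.module_hom_def)
qed (simp_all add: chain_pm_def chain_module_vectorspace)

lemma keys_sum_subset:
  "(\<And>x. x \<in> A \<Longrightarrow> Poly_Mapping.keys (h x) \<subseteq> B) \<Longrightarrow> Poly_Mapping.keys (sum h A) \<subseteq> B"
  using keys_sum[of h A] by blast

text \<open>The defining sum runs over the support, which changes under addition and scaling. A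
  common finite superset makes the sums comparable term by term.\<close>

lemma boundary_superset:
  assumes "finite A" "Poly_Mapping.keys c \<subseteq> A"
  shows "simplicial_boundary q c = (if q = 0 then 0
      else \<Sum>\<tau>\<in>A. \<Sum>v\<in>\<tau>. Poly_Mapping.single (\<tau> - {v}) (face_sign \<tau> v * Poly_Mapping.lookup c \<tau>))"
  using assms by (auto simp: simplicial_boundary_def in_keys_iff intro!: sum.mono_neutral_left)

lemma boundary_add: "simplicial_boundary q (c + d) = simplicial_boundary q c + simplicial_boundary q d"
  using Poly_Mapping.keys_add[of c d]
  by (simp add: boundary_superset[of "Poly_Mapping.keys c \<union> Poly_Mapping.keys d"] lookup_add
      distrib_left single_add sum.distrib)

lemma boundary_scal: "simplicial_boundary q (scal t c) = scal t (simplicial_boundary q c)"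
  using keys_scal[of t c]
  by (simp add: boundary_superset[of "Poly_Mapping.keys c"] lookup_scal scal_sum scal_simps mult.left_commute)

lemma boundary_closed:
  assumes L: "simplicial_complex L" and c: "Poly_Mapping.keys c \<subseteq> {\<tau> \<in> L. card \<tau> = Suc q}" and q: "q \<noteq> 0"
  shows "Poly_Mapping.keys (simplicial_boundary q c) \<subseteq> {\<tau> \<in> L. card \<tau> = q}"
proof -
  have "\<tau> - {v} \<in> L \<and> card (\<tau> - {v}) = q" if "\<tau> \<in> Poly_Mapping.keys c" "v \<in> \<tau>" for \<tau> v
  proof -
    have \<tau>: "\<tau> \<in> L" "card \<tau> = Suc q" using c that by auto
    then have card: "card (\<tau> - {v}) = q"
      using that by simp
    \<comment> \<open>A face of a simplex with q + 1 \<ge> 2 vertices is nonempty, as closure under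
      faces in a simplicial complex demands.\<close>
    have "\<tau> - {v} \<noteq> {}"
    proof
      assume "\<tau> - {v} = {}"
      then have "card (\<tau> - {v}) = 0" by (simp only: card.empty)
      then show False using card q by simp
    qed
    then show ?thesis
      using L[unfolded simplicial_complex_def, THEN conjunct2, rule_format, OF \<tau>(1), of "\<tau> - {v}"] card by simp
  qed
  then have single: "Poly_Mapping.keys (Poly_Mapping.single (\<tau> - {v}) y :: _ \<Rightarrow>\<^sub>0 'b) \<subseteq> {\<tau> \<in> L. card \<tau> = q}"
    if "\<tau> \<in> Poly_Mapping.keys c" "v \<in> \<tau>" for \<tau> v y
    using that by simp
  show ?thesis
    unfolding simplicial_boundary_def if_not_P[OF q] by (intro keys_sum_subset single)
qed

section \<open>Total complex\<close>

text \<open>\<open>field_type\<close> names the coefficient field, a type that occurs in neither I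
  nor U.\<close>

locale filtered_cover =
  fixes I :: "'i::linorder set" and U :: "'i \<Rightarrow> real \<Rightarrow> 'v::linorder set set"
    and field_type :: "'f::field itself"
  assumes finite_I: "finite I" and filtered_U: "i \<in> I \<Longrightarrow> filtered_complex (U i)"
begin

abbreviation "FF \<equiv> (ring_of_type_algebra :: 'f ring)"
abbreviation "\<Delta> \<equiv> index_simplices I"
abbreviation "Tot \<equiv> (tot_complex I U :: nat \<Rightarrow> ('f, ('i, 'v, 'f) tchain) pmod)"
abbreviation "dtot \<equiv> (tot_diff I :: nat \<Rightarrow> real \<Rightarrow> ('i, 'v, 'f) tchain \<Rightarrow> ('i, 'v, 'f) tchain)"
abbreviation "dcx \<equiv> (dcomplex I U :: nat \<Rightarrow> nat \<Rightarrow> ('f, ('i, 'v, 'f) dchain) pmod)"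

lemma filtered_Inter:
  assumes "\<sigma> \<in> \<Delta> p"
  shows "filtered_complex (\<lambda>r. \<Inter>i\<in>\<sigma>. U i r)"
proof -
  have \<sigma>: "\<sigma> \<subseteq> I" "\<sigma> \<noteq> {}"
    using assms by (auto simp: index_simplices_def)
  then have *: "\<And>i. i \<in> \<sigma> \<Longrightarrow> filtered_complex (U i)"
    using filtered_U by blast
  have "simplicial_complex (\<Inter>i\<in>\<sigma>. U i r)" for r
    unfolding simplicial_complex_def
  proof (intro conjI ballI allI impI)
    have sc: "simplicial_complex (U i r)" if "i \<in> \<sigma>" for i
      using *[OF that] by (simp add: filtered_complex_def)
    fix \<tau> assume "\<tau> \<in> (\<Inter>i\<in>\<sigma>. U i r)"
    then have \<tau>: "\<tau> \<in> U i r" if "i \<in> \<sigma>" for i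
      using that by simp
    \<comment> \<open>An index simplex has p + 1 elements, so the intersection is over a nonempty
      set and inherits finiteness of simplices from one member.\<close>
    obtain i where i: "i \<in> \<sigma>" using \<sigma> by blast
    show "finite \<tau>" "\<tau> \<noteq> {}"
      using sc[OF i, unfolded simplicial_complex_def, THEN conjunct1, rule_format, OF \<tau>[OF i]] by simp_all
    fix \<rho> assume "\<rho> \<subseteq> \<tau> \<and> \<rho> \<noteq> {}"
    then show "\<rho> \<in> (\<Inter>i\<in>\<sigma>. U i r)"
      using sc[unfolded simplicial_complex_def, THEN conjunct2, rule_format, OF _ \<tau>] by simp
  qed
  moreover have "(\<Inter>i\<in>\<sigma>. U i r) \<subseteq> (\<Inter>i\<in>\<sigma>. U i s)" if "r \<le> s" for r s
    using * that by (intro INT_anti_mono order_refl) (simp add: filtered_complex_def)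
  ultimately show ?thesis
    by (simp add: filtered_complex_def)
qed

lemma persistence_dcomplex: "persistence_module FF (dcx p q)"
  unfolding dcomplex_def
  by (intro persistence_module_dsum persistence_module_chain field_from_type_algebra)
    (use filtered_Inter in \<open>simp add: filtered_complex_def\<close>)

lemma persistence_tot: "persistence_module FF (Tot n)"
  unfolding tot_complex_def
  by (intro persistence_module_dsum persistence_dcomplex field_from_type_algebra)

text \<open>With finitely many indices, the finite support condition in the direct sums over index
  simplices is automatic.\<close>

lemma finite_simplices: "finite {\<sigma> \<in> \<Delta> p. P \<sigma>}"
  by (rule finite_subset[of _ "Pow I"]) (auto simp: index_simplices_def finite_I)

lemma tot_carrier:
  "x \<in> carrier (pspace (Tot n) r) \<longleftrightarrow> x \<in> extensional {..n} \<and>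
    (\<forall>p\<le>n. x p \<in> extensional (\<Delta> p) \<and>
      (\<forall>\<sigma>\<in>\<Delta> p. Poly_Mapping.keys (x p \<sigma>) \<subseteq> {\<tau> \<in> \<Inter>i\<in>\<sigma>. U i r. card \<tau> = Suc (n - p)}))"
  unfolding tot_complex_def dcomplex_def pm_dsum_def dsum_module_def chain_pm_def chain_module_def
  using finite_simplices by (simp add: PiE_iff) blast

lemma tot_add: "x \<oplus>\<^bsub>pspace (Tot n) r\<^esub> y = (\<lambda>p\<in>{..n}. \<lambda>\<sigma>\<in>\<Delta> p. x p \<sigma> + y p \<sigma>)"
  by (simp add: tot_complex_def dcomplex_def pm_dsum_def dsum_module_def chain_pm_def chain_module_def)

lemma tot_smult: "c \<odot>\<^bsub>pspace (Tot n) r\<^esub> x = (\<lambda>p\<in>{..n}. \<lambda>\<sigma>\<in>\<Delta> p. scal c (x p \<sigma>))"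
  by (simp add: tot_complex_def dcomplex_def pm_dsum_def dsum_module_def chain_pm_def chain_module_def)

lemma tot_zero: "\<zero>\<^bsub>pspace (Tot n) r\<^esub> = (\<lambda>p\<in>{..n}. \<lambda>\<sigma>\<in>\<Delta> p. 0)"
  by (simp add: tot_complex_def dcomplex_def pm_dsum_def dsum_module_def chain_pm_def chain_module_def)

lemma dcomplex_zero: "\<zero>\<^bsub>pspace (dcx p q) r\<^esub> = (\<lambda>\<sigma>\<in>\<Delta> p. 0)"
  by (simp add: dcomplex_def pm_dsum_def dsum_module_def chain_pm_def chain_module_def)

lemma tot_eqI:
  assumes "x \<in> extensional {..n}" "y \<in> extensional {..n}"
    and "\<And>p. p \<le> n \<Longrightarrow> x p \<in> extensional (\<Delta> p)" "\<And>p. p \<le> n \<Longrightarrow> y p \<in> extensional (\<Delta> p)"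
    and "\<And>p \<sigma>. p \<le> n \<Longrightarrow> \<sigma> \<in> \<Delta> p \<Longrightarrow> x p \<sigma> = y p \<sigma>"
  shows "x = y"
proof (rule extensionalityI[OF assms(1,2)])
  fix p assume "p \<in> {..n}"
  then show "x p = y p"
    using assms by (intro extensionalityI[of _ "\<Delta> p"]) auto
qed

text \<open>All structure maps are inclusions of chains, hence the identity on functions;
  extensionality of x takes care of the values outside the index sets.\<close>

lemma tot_map:
  assumes "x \<in> carrier (pspace (Tot n) r)"
  shows "pmap (Tot n) r s x = x"
proof -
  have "pmap (Tot n) r s x = (\<lambda>p\<in>{..n}. \<lambda>\<sigma>\<in>\<Delta> p. x p \<sigma>)"
    by (simp add: tot_complex_def dcomplex_def pm_dsum_def chain_pm_def)
  also have "\<dots> = x"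
    using assms by (intro tot_eqI[of _ n]) (auto simp: tot_carrier)
  finally show ?thesis .
qed

section \<open>The total differential\<close>

lemma insert_simplex: "\<sigma> \<in> \<Delta> p \<Longrightarrow> i \<in> I - \<sigma> \<Longrightarrow> insert i \<sigma> \<in> \<Delta> (Suc p)"
  using finite_I by (auto simp: index_simplices_def finite_subset)

text \<open>The exponent n - p is the second degree q of the target bidegree (p, n - p). The Cech
  differential does not change q, so this is the sign (-1)^q of the source as well.\<close>

lemma tot_diff_Suc:
  assumes "p \<le> n" "\<sigma> \<in> \<Delta> p"
  shows "dtot (Suc n) r x p \<sigma> = simplicial_boundary (Suc n - p) (x p \<sigma>) +
    scal ((-1) ^ (n - p)) (\<Sum>i\<in>I - \<sigma>. scal (face_sign (insert i \<sigma>) i) (x (Suc p) (insert i \<sigma>)))"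
  using assms by (simp add: tot_diff_def vdiff_def hdiff_def cech_diff_def)

text \<open>The vertical part stays in place because each intersection is closed under faces. The
  horizontal part does because adding an index to \<sigma> shrinks the intersection.\<close>

lemma tot_diff_closed:
  assumes x: "x \<in> carrier (pspace (Tot (Suc n)) r)"
  shows "dtot (Suc n) r x \<in> carrier (pspace (Tot n) r)"
  unfolding tot_carrier
proof (intro conjI allI impI ballI)
  show "dtot (Suc n) r x \<in> extensional {..n}"
    by (simp add: tot_diff_def)
  fix p assume p: "p \<le> n"
  then show "dtot (Suc n) r x p \<in> extensional (\<Delta> p)"
    by (simp add: tot_diff_def)
  fix \<sigma> assume \<sigma>: "\<sigma> \<in> \<Delta> p"
  have x\<sigma>: "Poly_Mapping.keys (x p \<sigma>) \<subseteq> {\<tau> \<in> \<Inter>i\<in>\<sigma>. U i r. card \<tau> = Suc (Suc n - p)}"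
    using x p \<sigma> unfolding tot_carrier by (meson le_SucI)
  have "Poly_Mapping.keys (simplicial_boundary (Suc n - p) (x p \<sigma>)) \<subseteq>
      {\<tau> \<in> \<Inter>i\<in>\<sigma>. U i r. card \<tau> = Suc n - p}"
    using filtered_Inter[OF \<sigma>] p by (intro boundary_closed x\<sigma>) (auto simp: filtered_complex_def)
  moreover have "Poly_Mapping.keys (scal ((-1) ^ (n - p)) (\<Sum>i\<in>I - \<sigma>.
      scal (face_sign (insert i \<sigma>) i) (x (Suc p) (insert i \<sigma>)))) \<subseteq> {\<tau> \<in> \<Inter>i\<in>\<sigma>. U i r. card \<tau> = Suc (n - p)}"
  proof (intro order_trans[OF keys_scal] keys_sum_subset)
    fix i assume "i \<in> I - \<sigma>"
    then have "Poly_Mapping.keys (x (Suc p) (insert i \<sigma>)) \<subseteq>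
        {\<tau> \<in> \<Inter>j\<in>insert i \<sigma>. U j r. card \<tau> = Suc (Suc n - Suc p)}"
      using x p insert_simplex[OF \<sigma>] unfolding tot_carrier by (meson Suc_le_mono)
    then show "Poly_Mapping.keys (x (Suc p) (insert i \<sigma>)) \<subseteq> {\<tau> \<in> \<Inter>i\<in>\<sigma>. U i r. card \<tau> = Suc (n - p)}"
      by auto
  qed
  \<comment> \<open>Reconciles the simplex sizes of the two parts; subtraction is truncated, so p
    \<le> n is needed.\<close>
  moreover have "Suc n - p = Suc (n - p)"
    using p by simp
  ultimately show "Poly_Mapping.keys (dtot (Suc n) r x p \<sigma>) \<subseteq> {\<tau> \<in> \<Inter>i\<in>\<sigma>. U i r. card \<tau> = Suc (n - p)}"
    unfolding tot_diff_Suc[OF p \<sigma>] using Poly_Mapping.keys_add by fastforce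
qed

lemma tot_diff_add:
  "dtot (Suc n) r (x \<oplus>\<^bsub>pspace (Tot (Suc n)) r\<^esub> y) = dtot (Suc n) r x \<oplus>\<^bsub>pspace (Tot n) r\<^esub> dtot (Suc n) r y"
proof (rule tot_eqI[of _ n])
  fix p \<sigma> assume p: "p \<le> n" and \<sigma>: "\<sigma> \<in> \<Delta> p"
  show "dtot (Suc n) r (x \<oplus>\<^bsub>pspace (Tot (Suc n)) r\<^esub> y) p \<sigma> =
      (dtot (Suc n) r x \<oplus>\<^bsub>pspace (Tot n) r\<^esub> dtot (Suc n) r y) p \<sigma>"
    unfolding tot_add using p \<sigma> insert_simplex[OF \<sigma>]
    by (simp add: tot_diff_Suc boundary_add scal_simps sum.distrib)
qed (simp_all add: tot_diff_def tot_add)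

lemma tot_diff_smult:
  "dtot (Suc n) r (c \<odot>\<^bsub>pspace (Tot (Suc n)) r\<^esub> x) = c \<odot>\<^bsub>pspace (Tot n) r\<^esub> dtot (Suc n) r x"
proof (rule tot_eqI[of _ n])
  fix p \<sigma> assume p: "p \<le> n" and \<sigma>: "\<sigma> \<in> \<Delta> p"
  have "(\<Sum>i\<in>I - \<sigma>. scal (face_sign (insert i \<sigma>) i) (scal c (x (Suc p) (insert i \<sigma>)))) =
      scal c (\<Sum>i\<in>I - \<sigma>. scal (face_sign (insert i \<sigma>) i) (x (Suc p) (insert i \<sigma>)))"
    unfolding scal_sum by (intro sum.cong refl scal_commute)
  then show "dtot (Suc n) r (c \<odot>\<^bsub>pspace (Tot (Suc n)) r\<^esub> x) p \<sigma> =
      (c \<odot>\<^bsub>pspace (Tot n) r\<^esub> dtot (Suc n) r x) p \<sigma>"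
    unfolding tot_smult using p \<sigma> insert_simplex[OF \<sigma>]
    by (simp add: tot_diff_Suc boundary_scal scal_simps(2) scal_commute[of "(-1) ^ (n - p)" c])
qed (simp_all add: tot_diff_def tot_smult)

lemma tot_diff_0: "dtot 0 r x = \<zero>\<^bsub>pspace (Tot 0) r\<^esub>"
  by (simp add: tot_diff_def tot_zero)

lemma tot_chain_complex: "pm_chain_complex FF Tot dtot"
proof (rule pm_chain_complex.intro)
  show "persistence_module FF (Tot n)" for n by (rule persistence_tot)
  show hom: "dtot n r \<in> LinearCombinations.module_hom FF (pspace (Tot n) r) (pspace (Tot (n - 1)) r)" for n r
  proof (cases n)
    \<comment> \<open>The target index 0 - 1 is again 0, and the differential there is zero.\<close>
    case 0
    interpret vectorspace FF "pspace (Tot 0) r"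
      by (rule persistence_module.vectorspace[OF persistence_tot])
    show ?thesis
      unfolding 0 by (simp add: LinearCombinations.module_hom_def tot_diff_0)
  next
    case (Suc n')
    then show ?thesis
      by (simp add: LinearCombinations.module_hom_def tot_diff_closed tot_diff_add tot_diff_smult)
  qed
  \<comment> \<open>Structure maps act as the identity on chains, and the formula for the
    differential does not involve r.\<close>
  show "dtot n s (pmap (Tot n) r s x) = pmap (Tot (n - 1)) r s (dtot n r x)"
    if "x \<in> carrier (pspace (Tot n) r)" for n r s x
  proof -
    have "dtot n r x \<in> carrier (pspace (Tot (n - 1)) r)"
      using LinearCombinations.module_hom_closed[OF hom] that by blast
    then have "pmap (Tot (n - 1)) r s (dtot n r x) = dtot n r x"
      by (rule tot_map)
    then show ?thesis
      using tot_map[OF that] by (simp add: tot_diff_def)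
  qed
qed

section \<open>The vertical filtration of the total complex\<close>

definition filt_carrier :: "int \<Rightarrow> nat \<Rightarrow> real \<Rightarrow> ('i, 'v, 'f) tchain set" where
  "filt_carrier \<kappa> n r = {x \<in> carrier (pspace (Tot n) r). \<forall>p\<le>n. \<kappa> < int p \<longrightarrow> x p = (\<lambda>\<sigma>\<in>\<Delta> p. 0)}"

lemma tot_filtered: "filtered_chain_complex FF Tot dtot (tot_filt I U) filt_carrier"
proof (rule filtered_chain_complex.intro[OF tot_chain_complex], rule filtered_chain_complex_axioms.intro)
  show "tot_filt I U \<kappa> n = \<lparr>pspace = (\<lambda>r. pspace (Tot n) r\<lparr>carrier := filt_carrier \<kappa> n r\<rparr>), pmap = pmap (Tot n)\<rparr>" for \<kappa> n
    by (simp add: tot_filt_def filt_carrier_def dcomplex_zero)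
  show "submodule FF (filt_carrier \<kappa> n r) (pspace (Tot n) r)" for \<kappa> n r
  proof -
    interpret vectorspace FF "pspace (Tot n) r"
      by (rule persistence_module.vectorspace[OF persistence_tot])
    show ?thesis
    proof (rule submodule.intro[OF module_axioms])
      show "filt_carrier \<kappa> n r \<subseteq> carrier (pspace (Tot n) r)"
        by (auto simp: filt_carrier_def)
      show "\<zero>\<^bsub>pspace (Tot n) r\<^esub> \<in> filt_carrier \<kappa> n r"
        using M.zero_closed by (simp add: filt_carrier_def) (simp add: tot_zero)
      show "x \<oplus>\<^bsub>pspace (Tot n) r\<^esub> y \<in> filt_carrier \<kappa> n r"
        if "x \<in> filt_carrier \<kappa> n r" "y \<in> filt_carrier \<kappa> n r" for x y
        using that by (simp add: filt_carrier_def) (simp add: tot_add cong: restrict_cong)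
      show "c \<odot>\<^bsub>pspace (Tot n) r\<^esub> x \<in> filt_carrier \<kappa> n r"
        if "c \<in> carrier FF" "x \<in> filt_carrier \<kappa> n r" for c x
        using that by (simp add: filt_carrier_def) (simp add: tot_smult scal_simps(1) cong: restrict_cong)
    qed
  qed
  show "filt_carrier \<kappa> n r \<subseteq> filt_carrier \<kappa>' n r" if "\<kappa> \<le> \<kappa>'" for \<kappa> \<kappa>' n r
    using that by (auto simp: filt_carrier_def)
  \<comment> \<open>Every p satisfies -1 < p, so all components vanish.\<close>
  show "filt_carrier (- 1) n r = {\<zero>\<^bsub>pspace (Tot n) r\<^esub>}" for n r
  proof -
    interpret vectorspace FF "pspace (Tot n) r"
      by (rule persistence_module.vectorspace[OF persistence_tot])
    have "x = \<zero>\<^bsub>pspace (Tot n) r\<^esub>" if "x \<in> filt_carrier (- 1) n r" for x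
      unfolding tot_zero using that
      by (intro tot_eqI[of _ n]) (auto simp: filt_carrier_def tot_carrier)
    moreover have "\<zero>\<^bsub>pspace (Tot n) r\<^esub> \<in> filt_carrier (- 1) n r"
      using M.zero_closed by (simp add: filt_carrier_def) (simp add: tot_zero)
    ultimately show ?thesis by blast
  qed
  show "filt_carrier (int n) n r = carrier (pspace (Tot n) r)" for n r
    by (auto simp: filt_carrier_def)
  show "pmap (Tot n) r s x \<in> filt_carrier \<kappa> n s" if rs: "r \<le> s" and x: "x \<in> filt_carrier \<kappa> n r" for r s x \<kappa> n
  proof -
    have "x \<in> carrier (pspace (Tot n) r)"
      using x by (simp add: filt_carrier_def)
    moreover from this have "x \<in> carrier (pspace (Tot n) s)"
      using LinearCombinations.module_hom_closed[OF persistence_module.map_hom[OF persistence_tot rs], THEN funcset_mem]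
      by (metis tot_map)
    ultimately show ?thesis
      using x by (simp add: filt_carrier_def tot_map)
  qed
qed

end

theorem proposition7:
  fixes K :: "real \<Rightarrow> 'v::linorder set set"
    and I :: "'i::linorder set" and U :: "'i \<Rightarrow> real \<Rightarrow> 'v set set"
    and n m :: nat and a b :: "nat \<Rightarrow> real" and k :: "nat \<Rightarrow> int"
    and g :: "nat \<Rightarrow> real \<Rightarrow> 'f::field \<Rightarrow> int \<Rightarrow> ('i, 'v, 'f) tchain set set"
    and l :: "nat \<Rightarrow> ('i, 'v, 'f) tchain set"
  assumes "filtered_complex K"
    and "finite I"
    and "\<And>i. i \<in> I \<Longrightarrow> filtered_complex (U i)"
    and "\<And>r. K r = (\<Union>i\<in>I. U i r)"
    and "barcode_basis ring_of_type_algebra (mv_graded I U n) {1..m} a b g"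
    and "\<And>i. i \<in> {1..m} \<Longrightarrow> k i \<in> {0..int n}"
    and "\<And>i r c. i \<in> {1..m} \<Longrightarrow>
      c \<in> carrier (pspace (interval_pm ring_of_type_algebra (a i) (b i)) r) \<Longrightarrow>
      g i r c \<in> dsum_incl {0..int n} (mv_graded_part I U n) (k i) r `
        carrier (pspace (mv_graded_part I U n (k i)) r)"
    and "\<And>i. i \<in> {1..m} \<Longrightarrow> l i \<in> carrier (pspace (mv_filt I U n (k i)) (a i))"
    and "\<And>i. i \<in> {1..m} \<Longrightarrow>
      dsum_incl {0..int n} (mv_graded_part I U n) (k i) (a i)
        (pm_proj (mv_filt I U n (k i)) (mv_filt I U n (k i - 1)) (a i) (l i)) =
      barcode_gen ring_of_type_algebra (mv_graded I U n) a b g i (a i)"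
  shows "pm_isomorphic ring_of_type_algebra
    (tilde_pm ring_of_type_algebra (mv_graded I U n) (mv_homology I U n) m a b g l)
    (mv_homology I U n)"
proof -
  interpret filtered_cover I U "TYPE('f)"
    using assms(2,3) by unfold_locales
  interpret T: filtered_chain_complex FF Tot dtot "tot_filt I U" filt_carrier
    by (rule tot_filtered)
  interpret H: filtered_pmod FF "mv_homology I U n" "T.W n" n
    unfolding mv_homology_def by (rule T.filtered_homology)
  \<comment> \<open>The filtration, its quotients and the graded module agree with the abstract ones
    as equalities, so generators and lifts carry over without translation.\<close>
  have filt: "mv_filt I U n \<kappa> = H.filt \<kappa>" for \<kappa>
    unfolding mv_filt_def mv_homology_def by (rule T.homology_filt_eq)
  have part: "mv_graded_part I U n = H.part"
    by (simp add: fun_eq_iff mv_graded_part_def H.part_def filt)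
  have graded: "mv_graded I U n = H.graded_pm"
    by (simp add: mv_graded_def H.graded_pm_def part)
  show ?thesis
    unfolding graded
  proof (rule H.tilde_isomorphic)
    show "barcode_basis FF H.graded_pm {1..m} a b g"
      using assms(5) by (simp only: graded)
    show "k i \<in> {0..int n}" if "i \<in> {1..m}" for i
      by (rule assms(6)[OF that])
    show "l i \<in> T.W n (k i) (a i)" if "i \<in> {1..m}" for i
      using assms(8)[OF that] by (simp add: filt H.filt_def)
    show "H.symb (a i) (k i) (l i) = barcode_gen FF H.graded_pm a b g i (a i)" if "i \<in> {1..m}" for i
      using assms(9)[OF that] by (simp only: H.symbol_eq filt part graded)
  qed
qed

end
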